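(* Consider the problem $\min_{x\in\mathbb{R}^d} L(x) := f(x)+R(x)$, where $f:\mathbb{R}^d\to\mathbb{R}$ is a smooth convex function and $\mathbf{M}\in\mathbb{R}^{d\times d}$ is a positive definite matrix such that $f(x+h)\le f(x)+(f'(x))^Th+\tfrac12 h^T\mathbf{M}h$ for all $x,h\in\mathbb{R}^d$, and where $R(x)=\sum_{i=1}^d R_i(x^i)$ with each $R_i:\mathbb{R}\to\mathbb{R}\cup\{+\infty\}$ convex and closed. Let $x_*$ be an optimal solution of this problem and $L^*:=L(x_* )$. Assume that $f$ and $R$ are strongly convex with respect to the norm $\|\cdot\|_{\mathbf{M}}$ with convexity parameters $\mu_f\ge 0$ and $\mu_R\ge 0$, respectively (parameter $0$ meaning just convexity), and that $\mu_f+\mu_R>0$. Let $d=cs$ with positive integers $c,s$, let $\{\mathcal{P}_1,\dots,\mathcal{P}_c\}$ be a partition of $\{1,\dots,d\}$ into $c$ sets of cardinality $s$, and let $\tau$ be an integer with $1\le\tau\le s$. Choose $x_0\in\mathbb{R}^d$, $0<\rho<1$, $0<\epsilon<L(x_0)-L^*$, a stepsize parameter $\beta\ge\beta^*$, and an iteration counter $T$ with $$T\ \ge\ \frac{d}{c\tau}\times\frac{\beta+\mu_R}{\mu_f+\mu_R}\times\log\left(\frac{L(x_0)-L^*}{\epsilon\rho}\right).$$ If $\{x_k\}_{k\ge0}$ are the random points generated by the algorithm Hydra started at $x_0$ with parameters $\{\mathcal{P}_1,\dots,\mathcal{P}_c\}$, $\beta$, $\tau$, then $$\mathbf{Prob}\big(L(x_T)-L^*\le\epsilon\big)\ge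 1-\rho.$$ Here $\beta^*$, $\|\cdot\|_{\mathbf{M}}$, strong convexity and Hydra are as defined in the context.
   Context: Notation: $x^i$ is the $i$-th coordinate of $x\in\mathbb{R}^d$; $f'(x)$ is the gradient of $f$ at $x$ and $f'_i(x)$ its $i$-th partial derivative. Norm and strong convexity: $\|x\|_{\mathbf{M}}^2:=\sum_{i=1}^d \mathbf{M}_{ii}(x^i)^2$. A function $\phi$ is strongly convex with respect to $\|\cdot\|_{\mathbf{M}}$ with parameter $\mu_\phi$ if for all $x,h\in\mathbb{R}^d$, $\phi(x+h)\ge\phi(x)+(\phi'(x))^Th+\tfrac{\mu_\phi}{2}\|h\|_{\mathbf{M}}^2$, where $\phi'(x)$ is a subgradient (or gradient) of $\phi$ at $x$. Stepsize bound $\beta^*$: Let $D^{\mathbf{M}}$ be the diagonal matrix with the same diagonal as $\mathbf{M}$, and $\mathbf{Q}:=(D^{\mathbf{M}})^{-1/2}\mathbf{M}(D^{\mathbf{M}})^{-1/2}$. Let $B^{\mathbf{Q}}\in\mathbb{R}^{d\times d}$ be the block diagonal of $\mathbf{Q}$ associated with the partition: $B^{\mathbf{Q}}_{ij}=\mathbf{Q}_{ij}$ if $i,j\in\mathcal{P}_l$ for some $l$, and $B^{\mathbf{Q}}_{ij}=0$ otherwise. Define $$\sigma':=\max\{x^T\mathbf{Q}x : x\in\mathbb{R}^d,\ x^TB^{\mathbf{Q}}x\le1\},\qquad \sigma:=\max\{x^T\mathbf{Q}x : x\in\mathbb{R}^d,\ x^Tx\le1\},$$ $s_1:=\max(1,s-1)$,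 and $$\beta^*:=1+\frac{(\tau-1)(\sigma-1)}{s_1}+\left(\frac{\tau}{s}-\frac{\tau-1}{s_1}\right)\frac{\sigma'-1}{\sigma'}\,\sigma .$$ Algorithm Hydra: starting from the deterministic point $x_0$, at each iteration $k=0,1,2,\dots$, for each $l\in\{1,\dots,c\}$ a random set $\hat S_l\subseteq\mathcal{P}_l$ is drawn uniformly from all subsets of $\mathcal{P}_l$ of cardinality $\tau$, independently for different $l$ and independently of previous iterations. For each $i\in\hat S:=\bigcup_{l=1}^c\hat S_l$ one computes $$h_k^i=\arg\min_{t\in\mathbb{R}}\ f'_i(x_k)\,t+\frac{\mathbf{M}_{ii}\beta}{2}t^2+R_i(x_k^i+t),$$ and sets $x_{k+1}^i=x_k^i+h_k^i$ for $i\in\hat S$ and $x_{k+1}^i=x_k^i$ for $i\notin\hat S$. *)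

theory Defs
  imports "HOL-Probability.Probability"
begin

(* Symmetry is not required: every quantity below depends on a matrix M only through
   its quadratic form and its diagonal. *)
definition positive_definite :: "real^'n^'n \<Rightarrow> bool" where
  "positive_definite M \<longleftrightarrow> (\<forall>x. x \<noteq> 0 \<longrightarrow> 0 < x \<bullet> (M *v x))"

(* The squared norm of x with respect to M; only the diagonal of M enters. *)
definition sqnorm :: "real^'n^'n \<Rightarrow> real^'n \<Rightarrow> real" where
  "sqnorm M x = (\<Sum>i\<in>UNIV. M $ i $ i * (x $ i)\<^sup>2)"

(* An extended-valued function is convex (closed) iff its epigraph is convex (closed). *)
definition ereal_epigraph :: "('a \<Rightarrow> ereal) \<Rightarrow> ('a \<times> real) set" where
  "ereal_epigraph \<phi> = {(x, r). \<phi> x \<le> ereal r}"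

definition is_subgradient :: "('a::real_inner \<Rightarrow> ereal) \<Rightarrow> 'a \<Rightarrow> 'a \<Rightarrow> bool" where
  "is_subgradient \<phi> x g \<longleftrightarrow> \<bar>\<phi> x\<bar> \<noteq> \<infinity> \<and> (\<forall>y. \<phi> x + ereal (g \<bullet> (y - x)) \<le> \<phi> y)"

(* The inequality is required at every point x and for every subgradient g at x: an
   extended-valued convex function has no subgradients outside its domain and may have
   none at relative boundary points. The convexity conjunct makes the parameter 0 mean
   just convexity. *)
definition strongly_convex :: "real^'n^'n \<Rightarrow> real \<Rightarrow> (real^'n \<Rightarrow> ereal) \<Rightarrow> bool" where
  "strongly_convex M \<mu> \<phi> \<longleftrightarrow>
     convex (ereal_epigraph \<phi>) \<and>
     (\<forall>x g. is_subgradient \<phi> x g \<longrightarrow>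
        (\<forall>h. \<phi> x + ereal (g \<bullet> h + \<mu> / 2 * sqnorm M h) \<le> \<phi> (x + h)))"

definition diag_inv_sqrt :: "real^'n^'n \<Rightarrow> real^'n^'n" where
  "diag_inv_sqrt M = (\<chi> i j. if i = j then 1 / sqrt (M $ i $ i) else 0)"

definition Qmat :: "real^'n^'n \<Rightarrow> real^'n^'n" where
  "Qmat M = diag_inv_sqrt M ** M ** diag_inv_sqrt M"

(* The blocks of the partition are P 1, ..., P c. *)
definition block_diag :: "nat \<Rightarrow> (nat \<Rightarrow> 'n set) \<Rightarrow> real^'n^'n \<Rightarrow> real^'n^'n" where
  "block_diag c P Q = (\<chi> i j. if \<exists>l\<in>{1..c}. i \<in> P l \<and> j \<in> P l then Q $ i $ j else 0)"

(* The suprema in the next two definitions are maxima when M is positive definite: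
   the feasible sets are then compact. *)
definition sigma_block :: "nat \<Rightarrow> (nat \<Rightarrow> 'n set) \<Rightarrow> real^'n^'n \<Rightarrow> real" where
  "sigma_block c P M =
     Sup {x \<bullet> (Qmat M *v x) | x. x \<bullet> (block_diag c P (Qmat M) *v x) \<le> 1}"

definition sigma :: "real^'n^'n \<Rightarrow> real" where
  "sigma M = Sup {x \<bullet> (Qmat M *v x) | x. x \<bullet> x \<le> 1}"

definition beta_star :: "nat \<Rightarrow> nat \<Rightarrow> nat \<Rightarrow> (nat \<Rightarrow> 'n set) \<Rightarrow> real^'n^'n \<Rightarrow> real" where
  "beta_star c s \<tau> P M =
     (let s1 = max 1 (real s - 1); \<sigma> = sigma M; \<sigma>' = sigma_block c P M in
        1 + (real \<tau> - 1) * (\<sigma> - 1) / s1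
          + (real \<tau> / real s - (real \<tau> - 1) / s1) * ((\<sigma>' - 1) / \<sigma>') * \<sigma>)"

definition objective :: "(real^'n \<Rightarrow> real) \<Rightarrow> ('n \<Rightarrow> real \<Rightarrow> ereal) \<Rightarrow> real^'n \<Rightarrow> ereal" where
  "objective f R x = ereal (f x) + (\<Sum>i\<in>UNIV. R i (x $ i))"

(* f' is the gradient of f. If R i is closed and convex, never -\<infinity>, finite at x $ i, and
   the quadratic coefficient is positive, then the minimiser exists and is unique. *)
definition hydra_dir ::
  "(real^'n \<Rightarrow> real^'n) \<Rightarrow> ('n \<Rightarrow> real \<Rightarrow> ereal) \<Rightarrow> real^'n^'n \<Rightarrow> real \<Rightarrow> real^'n \<Rightarrow> 'n \<Rightarrow> real" where
  "hydra_dir f' R M \<beta> x i =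
     arg_min (\<lambda>t. ereal (f' x $ i * t + M $ i $ i * \<beta> / 2 * t\<^sup>2) + R i (x $ i + t)) (\<lambda>t. True)"

(* The iterates for a given sequence S of sets of updated coordinates. *)
primrec hydra ::
  "(real^'n \<Rightarrow> real^'n) \<Rightarrow> ('n \<Rightarrow> real \<Rightarrow> ereal) \<Rightarrow> real^'n^'n \<Rightarrow> real \<Rightarrow> real^'n \<Rightarrow> (nat \<Rightarrow> 'n set)
     \<Rightarrow> nat \<Rightarrow> real^'n" where
  "hydra f' R M \<beta> x0 S 0 = x0"
| "hydra f' R M \<beta> x0 S (Suc k) =
     (let x = hydra f' R M \<beta> x0 S k in
        \<chi> i. if i \<in> S k then x $ i + hydra_dir f' R M \<beta> x i else x $ i)"

(* S k l is the random subset of the block P l drawn at iteration k. *)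
definition hydra_sampling ::
  "'w measure \<Rightarrow> nat \<Rightarrow> nat \<Rightarrow> (nat \<Rightarrow> 'n set) \<Rightarrow> (nat \<Rightarrow> nat \<Rightarrow> 'w \<Rightarrow> 'n set) \<Rightarrow> bool" where
  "hydra_sampling \<Omega> c \<tau> P S \<longleftrightarrow>
     (\<forall>k. \<forall>l\<in>{1..c}. distr \<Omega> (count_space UNIV) (S k l)
          = measure_pmf (pmf_of_set {A. A \<subseteq> P l \<and> card A = \<tau>})) \<and>
     prob_space.indep_vars \<Omega> (\<lambda>_. count_space UNIV) (\<lambda>(k, l). S k l) (UNIV \<times> {1..c})"

end

theory Submission
  imports Defs
begin

text \<open>
  The expectation of the quadratic form of \<open>M\<close> on a random partial step involves only the
  probabilities that two coordinates are updated together, and the definition of \<open>\<beta>\<^sup>*\<close> makes it at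
  most \<open>\<tau>/s \<cdot> \<beta>\<close> times the diagonal norm of the full step. Hence the expected new objective
  is bounded by a separable model, which each coordinate minimises exactly. Comparing with the
  step \<open>\<lambda>(x\<^sub>* - x)\<close>, where \<open>\<lambda> = (\<mu>\<^sub>f + \<mu>\<^sub>R) / (\<beta> + \<mu>\<^sub>R)\<close>, strong convexity shows that the expected gap
  contracts by the factor \<open>1 - \<tau>\<lambda>/s\<close>. Markov's inequality finishes the proof. Strong convexity of
  \<open>R\<close> is only given at points with a subgradient, so it is first transferred to the coordinate
  functions, which have subgradients at interior points of their domains.
\<close>

subsection \<open>Extended-valued convex functions on the line\<close>

text \<open>Origin of \<open>\<beta>\<^sup>*\<close>: two distinct coordinates are updated together
  with probability \<open>\<tau>/s * p\<close>, \<open>p = (\<tau>-1) / max 1 (s-1)\<close>, if they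
  share a block, and \<open>(\<tau>/s)^2\<close> otherwise. With \<open>N\<close>, \<open>B\<close>,
  \<open>C\<close> the diagonal, block and full quadratic forms of a step, the expected form is thus
  \<open>\<tau>/s\<close> times \<open>(1-p)*N + p*C + (\<tau>/s - p)*(C - B)\<close>, and the
  inequalities \<open>C \<le> \<sigma>*N\<close> and \<open>C \<le> \<sigma>'*B\<close> turn the
  second factor into \<open>\<beta>\<^sup>* * N\<close>. The factor \<lambda> is at most 1 because
  \<mu>f is at most 1 (compare the lower and upper bounds on \<open>f\<close>) and \<beta> is at
  least 1. Two obstacles shape the rest. The domain of \<open>R\<close> may have empty interior, so
  interior subgradients are available only after restricting to a line, where a nondegenerate
  segment does have interior. And the minimiser in \<open>hydra_dir\<close> is not evidently a
  measurable function of the point; but the first \<open>k\<close> iterates depend on finitely many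
  samples with finitely many values, so every random quantity is discrete and conditioning on the
  past is a finite sum.\<close>

lemma convex_real_of_epigraph:
  fixes \<phi> :: "'a::real_vector \<Rightarrow> ereal"
  assumes conv: "convex (ereal_epigraph \<phi>)" and proper: "\<And>x. \<phi> x \<noteq> -\<infinity>"
  shows "convex_on {x. \<phi> x \<noteq> \<infinity>} (\<lambda>x. real_of_ereal (\<phi> x))"
proof -
  have *: "\<phi> (u *\<^sub>R x + v *\<^sub>R y) \<le> ereal (u * real_of_ereal (\<phi> x) + v * real_of_ereal (\<phi> y))"
    if "\<phi> x \<noteq> \<infinity>" "\<phi> y \<noteq> \<infinity>" "0 \<le> u" "0 \<le> v" "u + v = 1" for x y u v
  proof -
    have "(x, real_of_ereal (\<phi> x)) \<in> ereal_epigraph \<phi>" "(y, real_of_ereal (\<phi> y)) \<in> ereal_epigraph \<phi>"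
      using that proper by (auto simp: ereal_epigraph_def ereal_real)
    from convexD[OF conv this that(3-5)] show ?thesis
      by (simp add: ereal_epigraph_def)
  qed
  show ?thesis
    unfolding convex_on_def
  proof (intro conjI ballI allI impI)
    show "convex {x. \<phi> x \<noteq> \<infinity>}"
      unfolding convex_def using * by fastforce
    fix x y u v
    assume h: "x \<in> {x. \<phi> x \<noteq> \<infinity>}" "y \<in> {x. \<phi> x \<noteq> \<infinity>}" "0 \<le> (u::real)" "0 \<le> v" "u + v = 1"
    with *[of x y u v] proper[of "u *\<^sub>R x + v *\<^sub>R y"]
    show "real_of_ereal (\<phi> (u *\<^sub>R x + v *\<^sub>R y)) \<le> u * real_of_ereal (\<phi> x) + v * real_of_ereal (\<phi> y)"
      by (cases "\<phi> (u *\<^sub>R x + v *\<^sub>R y)") auto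
  qed
qed

lemma is_subgradient_real_iff:
  fixes \<phi> :: "'a::real_inner \<Rightarrow> ereal"
  assumes proper: "\<And>x. \<phi> x \<noteq> -\<infinity>"
  shows "is_subgradient \<phi> x g \<longleftrightarrow> \<phi> x \<noteq> \<infinity> \<and>
    (\<forall>y. \<phi> y \<noteq> \<infinity> \<longrightarrow> real_of_ereal (\<phi> x) + g \<bullet> (y - x) \<le> real_of_ereal (\<phi> y))"
proof -
  have "(\<phi> x + ereal (g \<bullet> (y - x)) \<le> \<phi> y) \<longleftrightarrow>
      (\<phi> y \<noteq> \<infinity> \<longrightarrow> real_of_ereal (\<phi> x) + g \<bullet> (y - x) \<le> real_of_ereal (\<phi> y))"
    if "\<phi> x \<noteq> \<infinity>" for y
    using that proper[of x] proper[of y] by (cases "\<phi> x"; cases "\<phi> y") auto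
  then show ?thesis
    using proper[of x] unfolding is_subgradient_def by (cases "\<phi> x") auto
qed

lemma subgradient_exists_at_interior:
  fixes \<phi> :: "real \<Rightarrow> ereal"
  assumes conv: "convex (ereal_epigraph \<phi>)" and proper: "\<And>x. \<phi> x \<noteq> -\<infinity>"
    and z: "z \<in> interior {x. \<phi> x \<noteq> \<infinity>}"
  shows "\<exists>g. is_subgradient \<phi> z g"
proof -
  let ?D = "{x. \<phi> x \<noteq> \<infinity>}"
  \<comment> \<open>This is the right derivative at \<open>z\<close>: the infimum of the difference
    quotients towards points on its right.\<close>
  let ?g = "Inf ((\<lambda>t. (real_of_ereal (\<phi> z) - real_of_ereal (\<phi> t)) / (z - t)) ` ({z<..} \<inter> ?D))"
  have "real_of_ereal (\<phi> z) + ?g * (y - z) \<le> real_of_ereal (\<phi> y)" if "y \<in> ?D" for y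
    using convex_le_Inf_differential[OF convex_real_of_epigraph[OF conv proper] z that] by simp
  moreover have "\<phi> z \<noteq> \<infinity>" using interior_subset z by blast
  ultimately have "is_subgradient \<phi> z ?g"
    unfolding is_subgradient_real_iff[of \<phi>, OF proper] by simp
  then show ?thesis ..
qed

text \<open>Special to dimension one: an open segment is an open set. This is why strong convexity
  is treated coordinate by coordinate.\<close>

lemma open_segment_subset_interior_real:
  fixes a b :: real
  assumes "convex D" "a \<in> D" "b \<in> D" "z \<in> open_segment a b"
  shows "z \<in> interior D"
proof -
  have "open_segment a b \<subseteq> D"
    using assms(1-3) by (meson closed_segment_subset open_closed_segment subset_iff)
  moreover have "open (open_segment a b)"
    by (simp add: open_segment_eq_real_ivl)
  ultimately show ?thesis
    using assms(4) interior_maximal by blast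
qed

text \<open>If the domain has a second point, the midpoint is interior. Otherwise the domain is a
  single point, where every slope supports.\<close>

lemma subgradient_exists:
  fixes \<phi> :: "real \<Rightarrow> ereal"
  assumes conv: "convex (ereal_epigraph \<phi>)" and proper: "\<And>x. \<phi> x \<noteq> -\<infinity>"
    and a: "\<phi> a \<noteq> \<infinity>"
  shows "\<exists>z g. is_subgradient \<phi> z g"
proof (cases "\<exists>b. b \<noteq> a \<and> \<phi> b \<noteq> \<infinity>")
  case True
  then obtain b where b: "b \<noteq> a" "\<phi> b \<noteq> \<infinity>" by blast
  have "convex {x. \<phi> x \<noteq> \<infinity>}"
    using convex_real_of_epigraph[OF conv proper] by (rule convex_on_imp_convex)
  moreover have "midpoint a b \<in> open_segment a b"
    using b by simp
  ultimately have "midpoint a b \<in> interior {x. \<phi> x \<noteq> \<infinity>}"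
    using a b by (intro open_segment_subset_interior_real[of _ a b]) auto
  then show ?thesis
    using subgradient_exists_at_interior[OF conv proper] by blast
next
  case False
  then have "\<phi> y = \<infinity>" if "y \<noteq> a" for y using that by blast
  then have "is_subgradient \<phi> a 0"
    unfolding is_subgradient_real_iff[of \<phi>, OF proper] using a by (metis add_0_right diff_self inner_zero_left order_refl)
  then show ?thesis by blast
qed

text \<open>The endpoints may have no subgradient, but the intermediate point \<open>z\<close> is
  interior and has one. The inequality at \<open>z\<close> towards \<open>a\<close> and towards
  \<open>b\<close> is averaged with weights \<open>1 - t\<close> and \<open>t\<close>; the linear
  terms cancel because \<open>z\<close> is that average, and the squares leave
  \<open>t * (1 - t) * (b - a)^2\<close>.\<close>

lemma strong_convexity_from_subgradients:
  fixes \<phi> :: "real \<Rightarrow> ereal"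
  assumes conv: "convex (ereal_epigraph \<phi>)" and proper: "\<And>x. \<phi> x \<noteq> -\<infinity>"
    and strong: "\<And>z g h. is_subgradient \<phi> z g \<Longrightarrow> \<phi> z + ereal (g * h + m / 2 * h\<^sup>2) \<le> \<phi> (z + h)"
    and a: "\<phi> a \<noteq> \<infinity>" and b: "\<phi> b \<noteq> \<infinity>" and t: "0 \<le> t" "t \<le> 1"
  shows "real_of_ereal (\<phi> (a + t * (b - a)))
    \<le> (1 - t) * real_of_ereal (\<phi> a) + t * real_of_ereal (\<phi> b) - m / 2 * (t * (1 - t) * (b - a)\<^sup>2)"
proof (cases "a = b \<or> t = 0 \<or> t = 1")
  case True
  then show ?thesis by (auto simp: algebra_simps)
next
  case False
  define z where "z = a + t * (b - a)"
  have "convex {x. \<phi> x \<noteq> \<infinity>}"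
    using convex_real_of_epigraph[OF conv proper] by (rule convex_on_imp_convex)
  moreover have "z \<in> open_segment a b"
    using False t unfolding in_segment z_def by (auto intro!: exI[of _ t] simp: algebra_simps)
  ultimately have "z \<in> interior {x. \<phi> x \<noteq> \<infinity>}"
    using a b by (intro open_segment_subset_interior_real[of _ a b]) auto
  then obtain g where g: "is_subgradient \<phi> z g"
    using subgradient_exists_at_interior[OF conv proper] by blast
  then have z: "\<bar>\<phi> z\<bar> \<noteq> \<infinity>" unfolding is_subgradient_def by simp
  have *: "real_of_ereal (\<phi> z) + (g * (w - z) + m / 2 * (w - z)\<^sup>2) \<le> real_of_ereal (\<phi> w)"
    if "\<phi> w \<noteq> \<infinity>" for w
    using strong[OF g, of "w - z"] that proper[of w] z by (cases "\<phi> w"; cases "\<phi> z") auto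
  have "(1 - t) * (real_of_ereal (\<phi> z) + (g * (a - z) + m / 2 * (a - z)\<^sup>2))
      + t * (real_of_ereal (\<phi> z) + (g * (b - z) + m / 2 * (b - z)\<^sup>2))
      \<le> (1 - t) * real_of_ereal (\<phi> a) + t * real_of_ereal (\<phi> b)"
    using *[OF a] *[OF b] t by (intro add_mono mult_left_mono) auto
  moreover have "(1 - t) * (real_of_ereal (\<phi> z) + (g * (a - z) + m / 2 * (a - z)\<^sup>2))
      + t * (real_of_ereal (\<phi> z) + (g * (b - z) + m / 2 * (b - z)\<^sup>2))
      = real_of_ereal (\<phi> z) + m / 2 * (t * (1 - t) * (b - a)\<^sup>2)"
    unfolding z_def by (simp add: field_simps power2_eq_square)
  ultimately show ?thesis unfolding z_def by linarith
qed

text \<open>An affine minorant makes the sublevel sets bounded, so closedness of the epigraph gives a minimiser.\<close>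

lemma prox_is_arg_min:
  fixes \<phi> :: "real \<Rightarrow> ereal" and a b y :: real
  assumes conv: "convex (ereal_epigraph \<phi>)" and clos: "closed (ereal_epigraph \<phi>)"
    and proper: "\<And>x. \<phi> x \<noteq> -\<infinity>" and y: "\<phi> y \<noteq> \<infinity>" and b: "0 < b"
  defines "F \<equiv> \<lambda>t. ereal (a * t + b * t\<^sup>2) + \<phi> (y + t)"
  shows "is_arg_min F (\<lambda>_. True) (arg_min F (\<lambda>_. True))"
proof -
  obtain z g where "is_subgradient \<phi> z g"
    using subgradient_exists[OF conv proper y] by blast
  then have sub: "\<phi> w \<noteq> \<infinity> \<Longrightarrow> real_of_ereal (\<phi> z) + g * (w - z) \<le> real_of_ereal (\<phi> w)" for w
    unfolding is_subgradient_real_iff[of \<phi>, OF proper] by simp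
  define C where "C = real_of_ereal (\<phi> z) + g * (y - z)"
  define r0 where "r0 = real_of_ereal (\<phi> y)"
  have minor: "C + g * (w - y) \<le> r" if "(w, r) \<in> ereal_epigraph \<phi>" for w r
  proof -
    have "\<phi> w \<le> ereal r" using that by (simp add: ereal_epigraph_def)
    then have "\<phi> w \<noteq> \<infinity>" "real_of_ereal (\<phi> w) \<le> r" using proper[of w] by (cases "\<phi> w"; auto)+
    with sub[of w] show ?thesis unfolding C_def by (simp add: algebra_simps)
  qed
  \<comment> \<open>On the epigraph the height is a separate variable, so the function to minimise
    becomes continuous although \<open>\<phi>\<close> need not be. \<open>K\<close> is its sublevel
    set at \<open>r0\<close>, the value of \<open>F\<close> at step 0.\<close>
  let ?G = "\<lambda>p::real \<times> real. a * (fst p - y) + b * (fst p - y)\<^sup>2 + snd p"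
  define K where "K = ereal_epigraph \<phi> \<inter> {p. ?G p \<le> r0}"
  have yK: "(y, r0) \<in> K"
    using y proper[of y] by (cases "\<phi> y") (auto simp: K_def ereal_epigraph_def r0_def)
  \<comment> \<open>Beyond this distance \<open>u\<close> from \<open>y\<close> the quadratic term
    wins: \<open>b * u\<close> exceeds the slope \<open>\<bar>a + g\<bar>\<close> by at least
    \<open>1 + \<bar>r0 - C\<bar>\<close>. The final \<open>+ 1\<close> makes \<open>u\<close> at
    least 1, so multiplying by \<open>u\<close> keeps the excess.\<close>
  define N where "N = (\<bar>a + g\<bar> + 1 + \<bar>r0 - C\<bar>) / b + 1"
  have bw: "\<bar>w - y\<bar> \<le> N" if "(w, r) \<in> K" for w r
  proof (rule ccontr)
    assume "\<not> \<bar>w - y\<bar> \<le> N"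
    then have gt: "N < \<bar>w - y\<bar>" by simp
    let ?u = "\<bar>w - y\<bar>"
    have N1: "1 \<le> N" unfolding N_def using b by simp
    have "(a + g) * (w - y) + b * (w - y)\<^sup>2 \<le> r0 - C"
      using that minor[of w r] by (auto simp: K_def algebra_simps)
    moreover have "- (\<bar>a + g\<bar> * ?u) \<le> (a + g) * (w - y)"
      by (metis abs_ge_minus_self abs_mult minus_le_iff)
    ultimately have 1: "?u * (b * ?u - \<bar>a + g\<bar>) \<le> r0 - C"
      by (simp add: algebra_simps power2_eq_square)
    have "\<bar>a + g\<bar> + 1 + \<bar>r0 - C\<bar> \<le> b * N" unfolding N_def using b by (simp add: field_simps)
    also have "\<dots> \<le> b * ?u" using gt b by simp
    finally have 2: "1 + \<bar>r0 - C\<bar> \<le> b * ?u - \<bar>a + g\<bar>" by simp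
    have "1 * (1 + \<bar>r0 - C\<bar>) \<le> ?u * (b * ?u - \<bar>a + g\<bar>)"
      using 2 gt N1 by (intro mult_mono) auto
    from order_trans[OF this 1] show False by simp
  qed
  \<comment> \<open>The minorant bounds \<open>r\<close> from below; the sublevel condition, with
    the nonnegative square dropped, bounds it from above.\<close>
  have br: "\<bar>r\<bar> \<le> \<bar>C\<bar> + \<bar>g\<bar> * N + \<bar>r0\<bar> + \<bar>a\<bar> * N" if "(w, r) \<in> K" for w r
  proof -
    have "- (\<bar>k\<bar> * N) \<le> k * (w - y)" for k
    proof -
      have "\<bar>k * (w - y)\<bar> \<le> \<bar>k\<bar> * N"
        unfolding abs_mult using bw[OF that] by (intro mult_left_mono) auto
      then show ?thesis by (meson abs_le_D2 minus_le_iff)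
    qed
    from this[of g] this[of a]
    have "- (\<bar>g\<bar> * N) \<le> g * (w - y)" "- (\<bar>a\<bar> * N) \<le> a * (w - y)" .
    moreover have "C + g * (w - y) \<le> r" "a * (w - y) + b * (w - y)\<^sup>2 + r \<le> r0"
      using that minor[of w r] by (auto simp: K_def)
    moreover have "0 \<le> b * (w - y)\<^sup>2" using b by simp
    moreover have "0 \<le> \<bar>g\<bar> * N" "0 \<le> \<bar>a\<bar> * N" using bw[OF yK] by auto
    ultimately show ?thesis by linarith
  qed
  have "K \<subseteq> {y - N..y + N} \<times> {- (\<bar>C\<bar> + \<bar>g\<bar> * N + \<bar>r0\<bar> + \<bar>a\<bar> * N)..\<bar>C\<bar> + \<bar>g\<bar> * N + \<bar>r0\<bar> + \<bar>a\<bar> * N}"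
    using bw br by (fastforce simp: abs_le_iff)
  then have "bounded K"
    by (rule bounded_subset[rotated]) (intro bounded_Times bounded_closed_interval)
  moreover have "closed K"
    unfolding K_def by (intro closed_Int clos closed_Collect_le continuous_intros)
  ultimately have "compact K" by (simp add: compact_eq_bounded_closed)
  moreover have "continuous_on K ?G" by (intro continuous_intros)
  ultimately obtain p where p: "p \<in> K" "\<And>q. q \<in> K \<Longrightarrow> ?G p \<le> ?G q"
    using continuous_attains_inf[of K ?G] yK by blast
  have "F (fst p - y) \<le> F t" for t
  proof (cases "\<phi> (y + t) = \<infinity>")
    case True
    then show ?thesis by (simp add: F_def)
  next
    case False
    let ?q = "(y + t, real_of_ereal (\<phi> (y + t)))"
    have qE: "?q \<in> ereal_epigraph \<phi>" and Ft: "F t = ereal (?G ?q)"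
      using False proper[of "y + t"] by (auto simp: ereal_epigraph_def F_def ereal_real) (cases "\<phi> (y + t)"; simp)
    have "?G p \<le> ?G ?q"
    proof (cases "?q \<in> K")
      case True then show ?thesis by (rule p(2))
    next
      case False
      then have "r0 < ?G ?q" using qE unfolding K_def by auto
      moreover have "?G p \<le> r0" using p(1) by (simp add: K_def)
      ultimately show ?thesis by linarith
    qed
    moreover have "F (fst p - y) \<le> ereal (?G p)"
    proof -
      have "\<phi> (fst p) \<le> ereal (snd p)" using p(1) by (auto simp: K_def ereal_epigraph_def)
      then show ?thesis by (simp add: F_def) (metis add_left_mono plus_ereal.simps(1))
    qed
    ultimately show ?thesis unfolding Ft by (meson ereal_less_eq(3) order_trans)
  qed
  then have "is_arg_min F (\<lambda>_. True) (fst p - y)"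
    by (simp add: is_arg_min_def not_less)
  then show ?thesis unfolding arg_min_def by (rule someI)
qed

text \<open>The hypothesis speaks only of subgradients of the whole sum. The pair \<open>z\<close>,
  \<open>g\<close> is therefore completed by an arbitrary point with a subgradient in every other
  coordinate, and the displacement is taken along axis \<open>i\<close>. The other summands are
  finite and cancel.\<close>

lemma strongly_convex_separable_coordinate:
  fixes R :: "'n::finite \<Rightarrow> real \<Rightarrow> ereal"
  assumes strong: "strongly_convex M \<mu> (\<lambda>x. \<Sum>i\<in>UNIV. R i (x $ i))"
    and conv: "\<And>i. convex (ereal_epigraph (R i))" and proper: "\<And>i t. R i t \<noteq> -\<infinity>"
    and dom: "\<And>i. R i (x0 $ i) \<noteq> \<infinity>"
    and sub: "is_subgradient (R i) z g"
  shows "R i z + ereal (g * h + M $ i $ i * \<mu> / 2 * h\<^sup>2) \<le> R i (z + h)"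
proof -
  have "\<exists>z g. is_subgradient (R j) z g" for j
    using subgradient_exists[OF conv proper dom] .
  then obtain Z G where ZG: "\<And>j. is_subgradient (R j) (Z j) (G j)" by metis
  define x where "x = (\<chi> j. if j = i then z else Z j)"
  define G' where "G' = (\<chi> j. if j = i then g else G j)"
  define r where "r = (\<lambda>j. real_of_ereal (R j (x $ j)))"
  have sj: "is_subgradient (R j) (x $ j) (G' $ j)" for j
    using ZG sub by (simp add: x_def G'_def)
  then have rj: "R j (x $ j) = ereal (r j)" for j
    by (auto simp: r_def is_subgradient_def ereal_real)
  have sumr: "(\<Sum>j\<in>UNIV. R j (x $ j)) = ereal (\<Sum>j\<in>UNIV. r j)"
    by (simp add: rj)
  have "is_subgradient (\<lambda>x. \<Sum>i\<in>UNIV. R i (x $ i)) x G'"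
    unfolding is_subgradient_def
  proof (intro conjI allI)
    show "\<bar>\<Sum>j\<in>UNIV. R j (x $ j)\<bar> \<noteq> \<infinity>" by (simp add: sumr)
    fix y
    have "(\<Sum>j\<in>UNIV. R j (x $ j)) + ereal (G' \<bullet> (y - x))
        = (\<Sum>j\<in>UNIV. R j (x $ j) + ereal (G' $ j * (y $ j - x $ j)))"
      by (simp add: rj inner_vec_def sum.distrib)
    also have "\<dots> \<le> (\<Sum>j\<in>UNIV. R j (y $ j))"
      using sj by (intro sum_mono) (simp add: is_subgradient_def)
    finally show "(\<Sum>j\<in>UNIV. R j (x $ j)) + ereal (G' \<bullet> (y - x)) \<le> (\<Sum>j\<in>UNIV. R j (y $ j))" .
  qed
  then have "(\<Sum>j\<in>UNIV. R j (x $ j)) + ereal (G' \<bullet> axis i h + \<mu> / 2 * sqnorm M (axis i h))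
      \<le> (\<Sum>j\<in>UNIV. R j ((x + axis i h) $ j))"
    using strong unfolding strongly_convex_def by blast
  also have "G' \<bullet> axis i h = g * h" by (simp add: inner_axis G'_def)
  also have "sqnorm M (axis i h) = M $ i $ i * h\<^sup>2"
    by (simp add: sqnorm_def axis_def if_distrib[of "\<lambda>u. u ^ 2"] if_distrib[of "\<lambda>u. _ * u"] cong: if_cong)
  also have "(\<Sum>j\<in>UNIV. R j ((x + axis i h) $ j)) = R i (z + h) + (\<Sum>j\<in>UNIV - {i}. R j (x $ j))"
    by (subst sum.remove[of _ i]) (auto simp: x_def axis_def intro!: sum.cong)
  also have "(\<Sum>j\<in>UNIV. R j (x $ j)) = R i z + (\<Sum>j\<in>UNIV - {i}. R j (x $ j))"
    by (subst sum.remove[of _ i]) (auto simp: x_def)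
  finally have *: "R i z + (\<Sum>j\<in>UNIV - {i}. R j (x $ j)) + ereal (g * h + \<mu> / 2 * (M $ i $ i * h\<^sup>2))
      \<le> R i (z + h) + (\<Sum>j\<in>UNIV - {i}. R j (x $ j))" .
  have "(\<Sum>j\<in>UNIV - {i}. R j (x $ j)) = ereal (\<Sum>j\<in>UNIV - {i}. r j)"
    by (simp add: rj)
  moreover have "R i z = ereal (r i)" using rj[of i] by (simp add: x_def)
  ultimately show ?thesis
    using * by (cases "R i (z + h)") (auto simp: algebra_simps)
qed

subsection \<open>Quadratic forms and the stepsize bound\<close>

lemma quadratic_form_eq_sum:
  fixes A :: "real^'n^'n"
  shows "x \<bullet> (A *v x) = (\<Sum>i\<in>UNIV. \<Sum>j\<in>UNIV. A $ i $ j * (x $ i * x $ j))"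
  by (simp add: inner_vec_def matrix_vector_mult_def sum_distrib_left mult_ac)

lemma quadratic_form_axis:
  fixes A :: "real^'n^'n"
  shows "axis i t \<bullet> (A *v axis i t) = A $ i $ i * t\<^sup>2"
proof -
  have "(A *v axis i t) $ i = A $ i $ i * t"
    by (simp add: matrix_vector_mult_def axis_def if_distrib[of "\<lambda>u. _ * u"] cong: if_cong)
  then show ?thesis by (simp add: inner_axis' power2_eq_square)
qed

lemma quadratic_form_scale:
  fixes A :: "real^'n^'n"
  shows "(r *\<^sub>R x) \<bullet> (A *v (r *\<^sub>R x)) = r\<^sup>2 * (x \<bullet> (A *v x))"
  by (simp add: matrix_vector_mult_scaleR power2_eq_square)

lemma positive_definite_diag_pos: "positive_definite M \<Longrightarrow> 0 < M $ i $ i"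
  using quadratic_form_axis[of i 1 M] unfolding positive_definite_def
  by (metis axis_eq_0_iff mult.right_neutral one_power2 zero_neq_one)

lemma Qmat_nth: "Qmat M $ i $ j = M $ i $ j / (sqrt (M $ i $ i) * sqrt (M $ j $ j))"
  by (simp add: Qmat_def diag_inv_sqrt_def matrix_matrix_mult_def if_distrib[of "\<lambda>u. _ * u"]
      if_distrib[of "\<lambda>u. u * _"] cong: if_cong)

text \<open>The change of variables by the square root of the diagonal of \<open>M\<close>: it
  carries the forms of \<open>Qmat M\<close> to those of \<open>M\<close> and the Euclidean square
  to \<open>sqnorm M\<close>.\<close>

definition rescale :: "real^'n^'n \<Rightarrow> real^'n \<Rightarrow> real^'n" where
  "rescale M h = (\<chi> i. sqrt (M $ i $ i) * h $ i)"

lemma rescale_surj: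
  assumes "positive_definite M"
  obtains h where "x = rescale M h"
proof
  show "x = rescale M (\<chi> i. x $ i / sqrt (M $ i $ i))"
    using positive_definite_diag_pos[OF assms] by (simp add: rescale_def vec_eq_iff less_imp_neq[symmetric])
qed

lemma rescale_eq_0_iff:
  assumes "positive_definite M"
  shows "rescale M h = 0 \<longleftrightarrow> h = 0"
  using positive_definite_diag_pos[OF assms] by (simp add: rescale_def vec_eq_iff less_imp_neq[symmetric])

lemma block_quadratic_form_rescale:
  assumes "positive_definite M"
  shows "rescale M h \<bullet> (block_diag c P (Qmat M) *v rescale M h) = h \<bullet> (block_diag c P M *v h)"
  unfolding quadratic_form_eq_sum
  using positive_definite_diag_pos[OF assms]
  by (intro sum.cong) (auto simp: block_diag_def rescale_def Qmat_nth less_imp_neq[symmetric])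

lemma quadratic_form_rescale:
  assumes "positive_definite M"
  shows "rescale M h \<bullet> (Qmat M *v rescale M h) = h \<bullet> (M *v h)"
  unfolding quadratic_form_eq_sum
  using positive_definite_diag_pos[OF assms]
  by (intro sum.cong) (auto simp: rescale_def Qmat_nth less_imp_neq[symmetric])

lemma inner_rescale:
  assumes "positive_definite M"
  shows "rescale M h \<bullet> rescale M h = sqnorm M h"
  using positive_definite_diag_pos[OF assms]
  by (simp add: inner_vec_def rescale_def sqnorm_def power_mult_distrib less_imp_le
      flip: power2_eq_square)

lemma positive_definite_Qmat: "positive_definite M \<Longrightarrow> positive_definite (Qmat M)"
  by (metis positive_definite_def rescale_surj rescale_eq_0_iff quadratic_form_rescale)

text \<open>Scaling \<open>x\<close> by \<open>1 / sqrt (b x)\<close> puts it on the level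
  \<open>b = 1\<close>. The constant \<open>K\<close> only guarantees that the set is bounded above,
  without which \<open>Sup\<close> would carry no information.\<close>

lemma homogeneous_le_Sup:
  fixes q b :: "'a::real_vector \<Rightarrow> real"
  assumes q_hom: "\<And>r x. q (r *\<^sub>R x) = r\<^sup>2 * q x" and b_hom: "\<And>r x. b (r *\<^sub>R x) = r\<^sup>2 * b x"
    and b_pos: "\<And>x. x \<noteq> 0 \<Longrightarrow> 0 < b x"
    and K: "0 \<le> K" "\<And>x. q x \<le> K * b x"
  shows "q x \<le> Sup {q x | x. b x \<le> 1} * b x"
    and "b y \<le> 1 \<Longrightarrow> q y \<le> Sup {q x | x. b x \<le> 1}"
proof -
  have "bdd_above {q x | x. b x \<le> 1}"
  proof (rule bdd_aboveI)
    fix v assume "v \<in> {q x | x. b x \<le> 1}"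
    then obtain x where x: "v = q x" "b x \<le> 1" by blast
    have "v \<le> K * b x" using x K by simp
    also have "\<dots> \<le> K" using x K(1) mult_left_mono[of "b x" 1 K] by simp
    finally show "v \<le> K" .
  qed
  then show le: "b y \<le> 1 \<Longrightarrow> q y \<le> Sup {q x | x. b x \<le> 1}" for y
    by (intro cSup_upper) auto
  show "q x \<le> Sup {q x | x. b x \<le> 1} * b x"
  proof (cases "x = 0")
    case True
    then show ?thesis using q_hom[of 0 x] b_hom[of 0 x] by simp
  next
    case False
    let ?r = "1 / sqrt (b x)"
    have r: "?r\<^sup>2 = 1 / b x" using b_pos[OF False] by (simp add: power_divide)
    then have "b (?r *\<^sub>R x) \<le> 1" using b_pos[OF False] b_hom[of ?r x] by simp
    from le[OF this] q_hom[of ?r x] show ?thesis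
      unfolding r using b_pos[OF False] by (simp add: field_simps)
  qed
qed

lemma quadratic_form_bounded:
  fixes A :: "real^'n^'n"
  obtains K where "0 \<le> K" "\<And>x. x \<bullet> (A *v x) \<le> K * (x \<bullet> x)"
proof -
  obtain K where K: "0 < K" "\<And>x. norm (A *v x) \<le> norm x * K"
    using bounded_linear.pos_bounded[OF matrix_vector_mul_bounded_linear[of A]] by blast
  have "x \<bullet> (A *v x) \<le> K * (x \<bullet> x)" for x
  proof -
    have "x \<bullet> (A *v x) \<le> norm x * norm (A *v x)" by (rule norm_cauchy_schwarz)
    also have "\<dots> \<le> norm x * (norm x * K)" using K(2) by (intro mult_left_mono) auto
    finally show ?thesis by (simp add: dot_square_norm power2_eq_square mult_ac)
  qed
  then show ?thesis using K(1) that[of K] by simp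
qed

lemma convex_on_quadratic_form:
  fixes A :: "real^'n^'n"
  assumes "\<And>x. 0 \<le> x \<bullet> (A *v x)"
  shows "convex_on UNIV (\<lambda>x. x \<bullet> (A *v x))"
proof (rule convex_onI)
  fix t :: real and x y :: "real^'n"
  assume t: "0 < t" "t < 1"
  have "((1 - t) *\<^sub>R x + t *\<^sub>R y) \<bullet> (A *v ((1 - t) *\<^sub>R x + t *\<^sub>R y))
      = (1 - t) * (x \<bullet> (A *v x)) + t * (y \<bullet> (A *v y)) - t * (1 - t) * ((x - y) \<bullet> (A *v (x - y)))"
    by (simp add: matrix_vector_right_distrib matrix_vector_mult_diff_distrib matrix_vector_mult_scaleR
        inner_simps algebra_simps)
  moreover have "0 \<le> t * (1 - t) * ((x - y) \<bullet> (A *v (x - y)))"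
    using t assms by simp
  ultimately show "((1 - t) *\<^sub>R x + t *\<^sub>R y) \<bullet> (A *v ((1 - t) *\<^sub>R x + t *\<^sub>R y))
      \<le> (1 - t) * (x \<bullet> (A *v x)) + t * (y \<bullet> (A *v y))"
    by linarith
qed simp

text \<open>The lower bound comes from a coordinate vector, since \<open>Qmat M\<close> has unit
  diagonal.\<close>

lemma sigma_bound:
  assumes M: "positive_definite M"
  shows "h \<bullet> (M *v h) \<le> sigma M * sqnorm M h" and "1 \<le> sigma M"
proof -
  obtain K where "0 \<le> K" "\<And>x. x \<bullet> (Qmat M *v x) \<le> K * (x \<bullet> x)"
    using quadratic_form_bounded by blast
  note Sup = homogeneous_le_Sup[of "\<lambda>x. x \<bullet> (Qmat M *v x)" "\<lambda>x. x \<bullet> x", OF quadratic_form_scale _ _ this]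
  have "x \<bullet> (Qmat M *v x) \<le> sigma M * (x \<bullet> x)" for x
    unfolding sigma_def by (rule Sup(1)) (simp_all add: power2_eq_square)
  from this[of "rescale M h"] show "h \<bullet> (M *v h) \<le> sigma M * sqnorm M h"
    by (simp add: quadratic_form_rescale inner_rescale M)
  obtain i :: 'a where True by simp
  have "axis i 1 \<bullet> (Qmat M *v axis i 1) \<le> sigma M"
    unfolding sigma_def by (rule Sup(2)) (simp_all add: power2_eq_square inner_axis)
  then show "1 \<le> sigma M"
    using positive_definite_diag_pos[OF M, of i] by (simp add: quadratic_form_axis Qmat_nth)
qed

section \<open>Quadratic forms relative to the block partition\<close>

locale block_partition =
  fixes c s :: nat and P :: "nat \<Rightarrow> 'n::finite set"
  assumes s_pos: "0 < s"
    and disjoint: "disjoint_family_on P {1..c}"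
    and cover: "(\<Union>l\<in>{1..c}. P l) = UNIV"
    and card_P: "\<And>l. l \<in> {1..c} \<Longrightarrow> card (P l) = s"
begin

definition same_block :: "'n \<Rightarrow> 'n \<Rightarrow> bool" where
  "same_block i j \<longleftrightarrow> (\<exists>l\<in>{1..c}. i \<in> P l \<and> j \<in> P l)"

lemma block_exists: obtains l where "l \<in> {1..c}" "i \<in> P l"
  using cover by blast

lemma block_unique: "l \<in> {1..c} \<Longrightarrow> m \<in> {1..c} \<Longrightarrow> i \<in> P l \<Longrightarrow> i \<in> P m \<Longrightarrow> l = m"
  using disjoint unfolding disjoint_family_on_def by blast

lemma same_block_refl: "same_block i i"
  unfolding same_block_def using block_exists[of i] by blast

definition block_part :: "nat \<Rightarrow> real^'n \<Rightarrow> real^'n" where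
  "block_part l x = (\<chi> i. if i \<in> P l then x $ i else 0)"

lemma sum_block_part: "(\<Sum>l\<in>{1..c}. block_part l x) = x"
proof -
  have "(\<Sum>l\<in>{1..c}. if i \<in> P l then x $ i else 0) = x $ i" for i
  proof -
    obtain m where m: "m \<in> {1..c}" "i \<in> P m" by (rule block_exists)
    have "(\<Sum>l\<in>{1..c}. if i \<in> P l then x $ i else 0) = (\<Sum>l\<in>{1..c}. if l = m then x $ i else 0)"
      using m block_unique by (intro sum.cong) auto
    then show ?thesis using m by simp
  qed
  then show ?thesis by (simp add: vec_eq_iff block_part_def)
qed

lemma block_quadratic_form_eq_sum:
  "x \<bullet> (block_diag c P A *v x) = (\<Sum>l\<in>{1..c}. block_part l x \<bullet> (A *v block_part l x))"
proof -
  have "block_diag c P A $ i $ j * (x $ i * x $ j)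
      = (\<Sum>l\<in>{1..c}. A $ i $ j * (block_part l x $ i * block_part l x $ j))" for i j
  proof -
    obtain m where m: "m \<in> {1..c}" "i \<in> P m" by (rule block_exists)
    then have only: "l = m" if "l \<in> {1..c}" "i \<in> P l" for l
      using that block_unique by blast
    have "(\<Sum>l\<in>{1..c}. A $ i $ j * (block_part l x $ i * block_part l x $ j))
        = (\<Sum>l\<in>{1..c}. if l = m then A $ i $ j * (block_part m x $ i * block_part m x $ j) else 0)"
    proof (intro sum.cong refl)
      fix l assume "l \<in> {1..c}"
      then have "i \<in> P l \<longleftrightarrow> l = m" using m(2) only by blast
      then show "A $ i $ j * (block_part l x $ i * block_part l x $ j)
          = (if l = m then A $ i $ j * (block_part m x $ i * block_part m x $ j) else 0)"
        using m(2) by (simp add: block_part_def)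
    qed
    also have "\<dots> = block_diag c P A $ i $ j * (x $ i * x $ j)"
    proof -
      have "(\<exists>l\<in>{1..c}. i \<in> P l \<and> j \<in> P l) \<longleftrightarrow> j \<in> P m"
        using m only by blast
      then show ?thesis using m by (simp add: block_diag_def block_part_def)
    qed
    finally show ?thesis ..
  qed
  then have "x \<bullet> (block_diag c P A *v x)
      = (\<Sum>i\<in>UNIV. \<Sum>j\<in>UNIV. \<Sum>l\<in>{1..c}. A $ i $ j * (block_part l x $ i * block_part l x $ j))"
    by (simp add: quadratic_form_eq_sum)
  also have "\<dots> = (\<Sum>i\<in>UNIV. \<Sum>l\<in>{1..c}. \<Sum>j\<in>UNIV. A $ i $ j * (block_part l x $ i * block_part l x $ j))"
    by (intro sum.cong refl sum.swap)
  also have "\<dots> = (\<Sum>l\<in>{1..c}. block_part l x \<bullet> (A *v block_part l x))"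
    unfolding quadratic_form_eq_sum by (rule sum.swap)
  finally show ?thesis .
qed

text \<open>Jensen's inequality: \<open>x\<close> is the average of the \<open>c\<close> vectors
  \<open>c *\<^sub>R block_part l x\<close>. The crude constant \<open>c\<close> serves to show that
  the block form is positive definite and the set defining \<open>sigma_block\<close> is
  bounded.\<close>

lemma quadratic_form_le_block:
  assumes A: "\<And>x. 0 \<le> x \<bullet> (A *v x)"
  shows "x \<bullet> (A *v x) \<le> real c * (x \<bullet> (block_diag c P A *v x))"
proof -
  have c: "0 < c" using cover by (cases c) auto
  have "x = (\<Sum>l\<in>{1..c}. (1 / real c) *\<^sub>R (real c *\<^sub>R block_part l x))"
    using c sum_block_part[of x] by simp
  then have "x \<bullet> (A *v x) = (\<lambda>x. x \<bullet> (A *v x)) (\<Sum>l\<in>{1..c}. (1 / real c) *\<^sub>R (real c *\<^sub>R block_part l x))"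
    by simp
  also have "\<dots> \<le> (\<Sum>l\<in>{1..c}. (1 / real c) *
      ((real c *\<^sub>R block_part l x) \<bullet> (A *v (real c *\<^sub>R block_part l x))))"
    using c by (intro convex_on_sum[OF _ _ convex_on_quadratic_form[OF A]]) auto
  also have "\<dots> = real c * (x \<bullet> (block_diag c P A *v x))"
    using c unfolding quadratic_form_scale block_quadratic_form_eq_sum
    by (simp add: power2_eq_square sum_distrib_left)
  finally show ?thesis .
qed

lemma sigma_block_bound:
  assumes M: "positive_definite M"
  shows "h \<bullet> (M *v h) \<le> sigma_block c P M * (h \<bullet> (block_diag c P M *v h))"
    and "1 \<le> sigma_block c P M"
proof -
  have Q: "positive_definite (Qmat M)" by (rule positive_definite_Qmat[OF M])
  then have psd: "0 \<le> x \<bullet> (Qmat M *v x)" for x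
    unfolding positive_definite_def by (cases "x = 0") (auto simp: less_imp_le)
  have pos: "0 < x \<bullet> (block_diag c P (Qmat M) *v x)" if "x \<noteq> 0" for x
  proof -
    have "0 < x \<bullet> (Qmat M *v x)" using Q that unfolding positive_definite_def by blast
    also have "\<dots> \<le> real c * (x \<bullet> (block_diag c P (Qmat M) *v x))"
      using quadratic_form_le_block[OF psd] .
    finally show ?thesis by (simp add: zero_less_mult_iff)
  qed
  note Sup = homogeneous_le_Sup[of "\<lambda>x. x \<bullet> (Qmat M *v x)" "\<lambda>x. x \<bullet> (block_diag c P (Qmat M) *v x)",
      OF quadratic_form_scale quadratic_form_scale pos of_nat_0_le_iff quadratic_form_le_block[OF psd]]
  have "x \<bullet> (Qmat M *v x) \<le> sigma_block c P M * (x \<bullet> (block_diag c P (Qmat M) *v x))" for x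
    unfolding sigma_block_def by (rule Sup(1))
  from this[of "rescale M h"]
  show "h \<bullet> (M *v h) \<le> sigma_block c P M * (h \<bullet> (block_diag c P M *v h))"
    by (simp add: quadratic_form_rescale block_quadratic_form_rescale M)
  obtain i :: 'n where True by simp
  have one: "Qmat M $ i $ i = 1"
    using positive_definite_diag_pos[OF M, of i] by (simp add: Qmat_nth)
  moreover have "axis i 1 \<bullet> (block_diag c P (Qmat M) *v axis i 1) \<le> 1"
    using one by (simp add: quadratic_form_axis block_diag_def)
  then have "axis i 1 \<bullet> (Qmat M *v axis i 1) \<le> sigma_block c P M"
    unfolding sigma_block_def by (rule Sup(2)[rotated])
  ultimately show "1 \<le> sigma_block c P M"
    by (simp add: quadratic_form_axis)
qed

text \<open>The fraction is the conditional probability that a coordinate is drawn given that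
  another one of its block is. Drawing without replacement makes it at most the unconditional
  \<open>\<tau>/s\<close>: after clearing denominators the difference is \<open>s - \<tau>\<close>.
  For \<open>s = 1\<close> no such pair exists and \<open>max\<close> only prevents division by
  0.\<close>

lemma pair_coefficients:
  assumes tau: "1 \<le> \<tau>" "\<tau> \<le> s"
  shows "0 \<le> (real \<tau> - 1) / max 1 (real s - 1)"
    and "(real \<tau> - 1) / max 1 (real s - 1) \<le> real \<tau> / real s"
proof -
  show "0 \<le> (real \<tau> - 1) / max 1 (real s - 1)" using tau by simp
  show "(real \<tau> - 1) / max 1 (real s - 1) \<le> real \<tau> / real s"
  proof (cases "s = 1")
    case True then show ?thesis using tau by simp
  next
    case False
    then have "2 \<le> s" using s_pos by simp
    then have "max 1 (real s - 1) = real s - 1" "0 < real s - 1" by auto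
    then show ?thesis using tau s_pos by (simp add: divide_simps) (simp add: algebra_simps)
  qed
qed

text \<open>Needed for a positive quadratic coefficient in the coordinate problems and for
  \<open>rate \<le> 1\<close>.\<close>

lemma one_le_beta_star:
  assumes M: "positive_definite M" and tau: "1 \<le> \<tau>" "\<tau> \<le> s"
  shows "1 \<le> beta_star c s \<tau> P M"
proof -
  let ?p = "(real \<tau> - 1) / max 1 (real s - 1)"
  have "0 \<le> ?p * (sigma M - 1)"
    using pair_coefficients(1)[OF tau] sigma_bound(2)[OF M] by (intro mult_nonneg_nonneg) auto
  moreover have "0 \<le> (real \<tau> / real s - ?p) * ((sigma_block c P M - 1) / sigma_block c P M) * sigma M"
    using pair_coefficients(2)[OF tau] sigma_bound(2)[OF M] sigma_block_bound(2)[OF M]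
    by (intro mult_nonneg_nonneg) auto
  ultimately show ?thesis unfolding beta_star_def Let_def by simp
qed

text \<open>The left side is regrouped as \<open>(1-p)*N + p*C + (\<tau>/s - p)*(C - B)\<close>,
  whose last two coefficients are nonnegative. Then \<open>C\<close> is bounded by
  \<open>\<sigma>*N\<close>, and \<open>C - B\<close> by \<open>(1 - 1/\<sigma>')*C\<close> because
  \<open>B\<close> is at least \<open>C/\<sigma>'\<close>.\<close>

lemma beta_star_quadratic_bound:
  assumes M: "positive_definite M" and tau: "1 \<le> \<tau>" "\<tau> \<le> s"
  defines "p \<equiv> (real \<tau> - 1) / max 1 (real s - 1)"
  shows "(1 - p) * sqnorm M h + p * (h \<bullet> (block_diag c P M *v h))
      + real \<tau> / real s * (h \<bullet> (M *v h) - h \<bullet> (block_diag c P M *v h))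
    \<le> beta_star c s \<tau> P M * sqnorm M h"
proof -
  let ?N = "sqnorm M h" and ?B = "h \<bullet> (block_diag c P M *v h)" and ?C = "h \<bullet> (M *v h)"
  let ?\<sigma> = "sigma M" and ?\<sigma>' = "sigma_block c P M"
  have s': "1 \<le> ?\<sigma>'" by (rule sigma_block_bound(2)[OF M])
  have C: "?C \<le> ?\<sigma> * ?N" by (rule sigma_bound(1)[OF M])
  have "?C / ?\<sigma>' \<le> ?B"
    using sigma_block_bound(1)[OF M, of h] s' by (simp add: divide_le_eq mult.commute)
  then have "?C - ?B \<le> (?\<sigma>' - 1) / ?\<sigma>' * ?C"
    using s' by (simp add: diff_divide_distrib algebra_simps)
  also have "\<dots> \<le> (?\<sigma>' - 1) / ?\<sigma>' * (?\<sigma> * ?N)"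
    using s' C by (intro mult_left_mono) auto
  finally have "(real \<tau> / real s - p) * (?C - ?B)
      \<le> (real \<tau> / real s - p) * ((?\<sigma>' - 1) / ?\<sigma>' * (?\<sigma> * ?N))"
    using pair_coefficients(2)[OF tau] unfolding p_def by (intro mult_left_mono) auto
  moreover have "p * ?C \<le> p * (?\<sigma> * ?N)"
    using C pair_coefficients(1)[OF tau] unfolding p_def by (intro mult_left_mono) auto
  moreover have "beta_star c s \<tau> P M * ?N = ?N + p * (?\<sigma> * ?N) - p * ?N
      + (real \<tau> / real s - p) * ((?\<sigma>' - 1) / ?\<sigma>' * (?\<sigma> * ?N))"
    unfolding beta_star_def Let_def p_def by (simp add: algebra_simps diff_divide_distrib add_divide_distrib)
  moreover have "(1 - p) * ?N + p * ?B + real \<tau> / real s * (?C - ?B)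
      = ?N - p * ?N + p * ?C + (real \<tau> / real s - p) * (?C - ?B)"
    by (simp add: algebra_simps)
  ultimately show ?thesis by linarith
qed

end

subsection \<open>Block sampling\<close>

text \<open>Such a set is determined by its elements outside \<open>J\<close>.\<close>

lemma card_supersets_of_size:
  assumes "finite B" "J \<subseteq> B" "card J \<le> k"
  shows "card {A. A \<subseteq> B \<and> card A = k \<and> J \<subseteq> A} = (card B - card J) choose (k - card J)"
proof -
  have finJ: "finite J" using assms finite_subset by blast
  have "bij_betw (\<lambda>A. A \<union> J) {A. A \<subseteq> B - J \<and> card A = k - card J}
      {A. A \<subseteq> B \<and> card A = k \<and> J \<subseteq> A}"
  proof (rule bij_betw_byWitness[where f' = "\<lambda>A. A - J"])
    show "(\<lambda>A. A \<union> J) ` {A. A \<subseteq> B - J \<and> card A = k - card J} \<subseteq> {A. A \<subseteq> B \<and> card A = k \<and> J \<subseteq> A}"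
    proof safe
      fix A assume A: "A \<subseteq> B - J" "card A = k - card J"
      then have "finite A" using assms(1) by (meson finite_Diff finite_subset)
      then show "card (A \<union> J) = k"
        using A assms(3) finJ by (subst card_Un_disjoint) auto
    qed (use assms(2) in auto)
    show "(\<lambda>A. A - J) ` {A. A \<subseteq> B \<and> card A = k \<and> J \<subseteq> A} \<subseteq> {A. A \<subseteq> B - J \<and> card A = k - card J}"
      using finJ by (auto simp: card_Diff_subset)
  qed auto
  then have "card {A. A \<subseteq> B \<and> card A = k \<and> J \<subseteq> A} = card {A. A \<subseteq> B - J \<and> card A = k - card J}"
    by (simp add: bij_betw_same_card)
  also have "\<dots> = card (B - J) choose (k - card J)"
    using assms(1) by (intro n_subsets) auto
  also have "card (B - J) = card B - card J"
    using finJ assms(2) by (rule card_Diff_subset)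
  finally show ?thesis .
qed

locale uniform_block_sampling = prob_space \<Omega> + block_partition c s P
  for \<Omega> :: "'w measure" and c s :: nat and P :: "nat \<Rightarrow> 'n::finite set" +
  fixes \<tau> :: nat and S :: "nat \<Rightarrow> nat \<Rightarrow> 'w \<Rightarrow> 'n set"
  assumes tau: "1 \<le> \<tau>" "\<tau> \<le> s"
    and sampling: "hydra_sampling \<Omega> c \<tau> P S"
begin

definition updated :: "nat \<Rightarrow> 'w \<Rightarrow> 'n set" where
  "updated k \<omega> = (\<Union>l\<in>{1..c}. S k l \<omega>)"

lemma indep_S: "indep_vars (\<lambda>_. count_space UNIV) (\<lambda>(k, l). S k l) (UNIV \<times> {1..c})"
  using sampling by (simp add: hydra_sampling_def)

lemma measurable_S: "l \<in> {1..c} \<Longrightarrow> S k l \<in> measurable \<Omega> (count_space UNIV)"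
  using indep_S unfolding indep_vars_def by auto

lemma card_choices: "l \<in> {1..c} \<Longrightarrow> card {A. A \<subseteq> P l \<and> card A = \<tau>} = s choose \<tau>"
  using n_subsets[of "P l" \<tau>] card_P by simp

lemma choices_nonempty: "l \<in> {1..c} \<Longrightarrow> {A. A \<subseteq> P l \<and> card A = \<tau>} \<noteq> {}"
  using card_choices tau by (metis binomial_eq_0_iff card.empty not_less)

lemma prob_S_eq:
  assumes l: "l \<in> {1..c}"
  shows "prob (S k l -` X \<inter> space \<Omega>) = real (card ({A. A \<subseteq> P l \<and> card A = \<tau>} \<inter> X)) / real (s choose \<tau>)"
proof -
  have "prob (S k l -` X \<inter> space \<Omega>) = measure (distr \<Omega> (count_space UNIV) (S k l)) X"
    using measurable_S[OF l] by (simp add: measure_distr)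
  also have "\<dots> = measure (measure_pmf (pmf_of_set {A. A \<subseteq> P l \<and> card A = \<tau>})) X"
    using sampling l by (simp add: hydra_sampling_def)
  also have "\<dots> = real (card ({A. A \<subseteq> P l \<and> card A = \<tau>} \<inter> X)) / real (s choose \<tau>)"
    using choices_nonempty[OF l] card_choices[OF l] by (subst measure_pmf_of_set) auto
  finally show ?thesis .
qed

text \<open>Only the distribution of \<open>S k l\<close> is prescribed, so a sample may leave its
  block on a null set. Statements about which block supplied a coordinate therefore hold almost
  everywhere only.\<close>

lemma S_subset_AE:
  assumes l: "l \<in> {1..c}"
  shows "AE \<omega> in \<Omega>. S k l \<omega> \<subseteq> P l"
proof -
  have "prob (S k l -` {A. A \<subseteq> P l} \<inter> space \<Omega>) = real (card {A. A \<subseteq> P l \<and> card A = \<tau>}) / real (s choose \<tau>)"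
    unfolding prob_S_eq[OF l] by (intro arg_cong2[where f = "(/)"] arg_cong[where f = "\<lambda>X. real (card X)"]) auto
  also have "\<dots> = 1" using card_choices[OF l] tau by simp
  finally have "AE \<omega> in \<Omega>. \<omega> \<in> S k l -` {A. A \<subseteq> P l} \<inter> space \<Omega>"
    using measurable_sets[OF measurable_S[OF l], of "{A. A \<subseteq> P l}" k] by (subst (asm) prob_eq_1) auto
  then show ?thesis by eventually_elim auto
qed

lemma updated_mem_iff_AE:
  assumes l: "l \<in> {1..c}" "i \<in> P l"
  shows "AE \<omega> in \<Omega>. i \<in> updated k \<omega> \<longleftrightarrow> i \<in> S k l \<omega>"
proof -
  have "AE \<omega> in \<Omega>. \<forall>m\<in>{1..c}. S k m \<omega> \<subseteq> P m"
    by (rule AE_finite_allI) (auto intro: S_subset_AE)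
  then show ?thesis
  proof eventually_elim
    case (elim \<omega>)
    then show ?case unfolding updated_def using l block_unique by blast
  qed
qed

lemma prob_S_contains:
  assumes l: "l \<in> {1..c}" and J: "J \<subseteq> P l" "card J \<le> \<tau>"
  shows "prob {\<omega> \<in> space \<Omega>. J \<subseteq> S k l \<omega>}
    = real ((s - card J) choose (\<tau> - card J)) / real (s choose \<tau>)"
proof -
  have "{\<omega> \<in> space \<Omega>. J \<subseteq> S k l \<omega>} = S k l -` {A. J \<subseteq> A} \<inter> space \<Omega>" by auto
  moreover have "{A. A \<subseteq> P l \<and> card A = \<tau>} \<inter> {A. J \<subseteq> A} = {A. A \<subseteq> P l \<and> card A = \<tau> \<and> J \<subseteq> A}"
    by auto
  ultimately show ?thesis
    using prob_S_eq[OF l, of k "{A. J \<subseteq> A}"] card_supersets_of_size[of "P l" J \<tau>] J card_P[OF l]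
    by simp
qed

lemma prob_S_single:
  assumes l: "l \<in> {1..c}" "i \<in> P l"
  shows "prob {\<omega> \<in> space \<Omega>. i \<in> S k l \<omega>} = real \<tau> / real s"
proof -
  have "real \<tau> * real (s choose \<tau>) = real s * real ((s - 1) choose (\<tau> - 1))"
    using times_binomial_minus1_eq[of \<tau> s] tau by (metis of_nat_mult less_eq_Suc_le One_nat_def)
  moreover have "prob {\<omega> \<in> space \<Omega>. i \<in> S k l \<omega>} = real ((s - 1) choose (\<tau> - 1)) / real (s choose \<tau>)"
    using prob_S_contains[of l "{i}" k] l tau by simp
  moreover have "0 < real (s choose \<tau>)" using tau by simp
  ultimately show ?thesis using s_pos by (simp add: frac_eq_eq mult_ac)
qed

lemma prob_S_pair:
  assumes l: "l \<in> {1..c}" "i \<in> P l" "j \<in> P l" and ij: "i \<noteq> j"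
  shows "prob {\<omega> \<in> space \<Omega>. i \<in> S k l \<omega> \<and> j \<in> S k l \<omega>}
    = real \<tau> / real s * ((real \<tau> - 1) / (real s - 1))"
proof -
  have "finite (P l)" by simp
  then have s2: "2 \<le> s" using card_mono[of "P l" "{i, j}"] l ij card_P[OF l(1)] by simp
  show ?thesis
  \<comment> \<open>For \<open>\<tau> = 1\<close> the truncated difference \<open>\<tau> - 2\<close>
    would be 0 and the binomial quotient positive, whereas a one-element set never contains both
    coordinates.\<close>
  proof (cases "\<tau> = 1")
    case True
    have "{A. A \<subseteq> P l \<and> card A = \<tau>} \<inter> {A. i \<in> A \<and> j \<in> A} = {}"
      using ij True by (auto simp: card_1_singleton_iff)
    moreover have "{\<omega> \<in> space \<Omega>. i \<in> S k l \<omega> \<and> j \<in> S k l \<omega>} = S k l -` {A. i \<in> A \<and> j \<in> A} \<inter> space \<Omega>"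
      by auto
    ultimately show ?thesis using prob_S_eq[OF l(1), of k "{A. i \<in> A \<and> j \<in> A}"] True by simp
  next
    case False
    then have t2: "2 \<le> \<tau>" using tau by simp
    have "real \<tau> * real (s choose \<tau>) = real s * real ((s - 1) choose (\<tau> - 1))"
      using times_binomial_minus1_eq[of \<tau> s] tau by (metis of_nat_mult less_eq_Suc_le One_nat_def)
    moreover have "real (\<tau> - 1) * real ((s - 1) choose (\<tau> - 1)) = real (s - 1) * real ((s - 2) choose (\<tau> - 2))"
      using times_binomial_minus1_eq[of "\<tau> - 1" "s - 1"] t2
      by (metis of_nat_mult diff_diff_left one_add_one zero_less_diff less_le_trans one_less_numeral_iff semiring_norm(76))
    ultimately have "(real \<tau> * (real \<tau> - 1)) * real (s choose \<tau>)
        = (real s * (real s - 1)) * real ((s - 2) choose (\<tau> - 2))"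
      using t2 s2 by (simp add: of_nat_diff) algebra
    moreover have "prob {\<omega> \<in> space \<Omega>. i \<in> S k l \<omega> \<and> j \<in> S k l \<omega>}
        = real ((s - 2) choose (\<tau> - 2)) / real (s choose \<tau>)"
      using prob_S_contains[of l "{i, j}" k] l ij t2 by (simp add: numeral_2_eq_2)
    moreover have "0 < real (s choose \<tau>)" using tau by simp
    ultimately show ?thesis using s2 by (simp add: frac_eq_eq mult_ac)
  qed
qed

text \<open>The probability that \<open>i\<close> is updated times the conditional probability that
  \<open>j\<close> is updated too.\<close>

definition pair_prob :: "'n \<Rightarrow> 'n \<Rightarrow> real" where
  "pair_prob i j = real \<tau> / real s *
    (if i = j then 1 else if same_block i j then (real \<tau> - 1) / max 1 (real s - 1) else real \<tau> / real s)"

section \<open>Independence of the past and the current sample\<close>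

definition history :: "nat \<Rightarrow> 'w \<Rightarrow> nat \<times> nat \<Rightarrow> 'n set" where
  "history k \<omega> = restrict (\<lambda>i. (\<lambda>(k, l). S k l) i \<omega>) ({..<k} \<times> {1..c})"

lemma updated_from_history: "j < k \<Longrightarrow> updated j \<omega> = (\<Union>l\<in>{1..c}. history k \<omega> (j, l))"
  by (simp add: updated_def history_def)

text \<open>A finite product of finite discrete spaces is discrete, so every function on it is
  measurable.\<close>

lemma measurable_from_samples:
  assumes "finite A"
  shows "g \<in> measurable (PiM A (\<lambda>_. count_space (UNIV :: 'n set set))) (count_space UNIV)"
  using assms by (simp add: count_space_PiM_finite countable_finite)

text \<open>\<open>\<Phi>\<close> stands for any quantity determined by the first \<open>k\<close>
  update sets, later the iterate itself. It factors through finitely many samples with finitely many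
  values, so the minimiser in \<open>hydra_dir\<close> needs no measurability argument of its
  own.\<close>

lemma measurable_history:
  assumes past: "\<And>A B. (\<And>j. j < k \<Longrightarrow> A j = B j) \<Longrightarrow> \<Phi> A = \<Phi> B"
  shows "(\<lambda>\<omega>. \<Phi> (\<lambda>j. updated j \<omega>)) \<in> measurable \<Omega> (count_space UNIV)"
    and "finite ((\<lambda>\<omega>. \<Phi> (\<lambda>j. updated j \<omega>)) ` space \<Omega>)"
proof -
  let ?H = "{..<k} \<times> {1..c}"
  define G where "G = (\<lambda>F :: nat \<times> nat \<Rightarrow> 'n set. \<Phi> (\<lambda>j. \<Union>l\<in>{1..c}. F (j, l)))"
  have eq: "(\<lambda>\<omega>. \<Phi> (\<lambda>j. updated j \<omega>)) = (\<lambda>\<omega>. G (history k \<omega>))"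
    unfolding G_def by (intro ext past) (simp add: updated_from_history)
  have "history k \<in> measurable \<Omega> (PiM ?H (\<lambda>_. count_space UNIV))"
    unfolding history_def by (intro measurable_restrict) (auto simp: measurable_S)
  then show "(\<lambda>\<omega>. \<Phi> (\<lambda>j. updated j \<omega>)) \<in> measurable \<Omega> (count_space UNIV)"
    unfolding eq by (rule measurable_compose) (rule measurable_from_samples, simp)
  have "(\<lambda>\<omega>. G (history k \<omega>)) ` space \<Omega> \<subseteq> G ` (PiE ?H (\<lambda>_. UNIV))"
    unfolding history_def by auto
  moreover have "finite (PiE ?H (\<lambda>_. UNIV :: 'n set set))"
    by (intro finite_PiE) auto
  ultimately show "finite ((\<lambda>\<omega>. \<Phi> (\<lambda>j. updated j \<omega>)) ` space \<Omega>)"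
    unfolding eq by (meson finite_imageI finite_subset)
qed

text \<open>The samples before iteration \<open>k\<close> and those at iteration \<open>k\<close>
  have disjoint index sets in one independent family.\<close>

lemma indep_history:
  fixes \<Phi> :: "(nat \<Rightarrow> 'n set) \<Rightarrow> real" and h :: "'n set \<Rightarrow> real"
  assumes past: "\<And>A B. (\<And>j. j < k \<Longrightarrow> A j = B j) \<Longrightarrow> \<Phi> A = \<Phi> B"
  shows "indep_var borel (\<lambda>\<omega>. \<Phi> (\<lambda>j. updated j \<omega>)) borel (\<lambda>\<omega>. h (updated k \<omega>))"
proof -
  let ?H = "{..<k} \<times> {1..c}" and ?N = "{k} \<times> {1..c}"
  let ?U = "\<lambda>(F :: nat \<times> nat \<Rightarrow> 'n set) j. \<Union>l\<in>{1..c}. F (j, l)"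
  let ?X = "\<lambda>A \<omega>. restrict (\<lambda>i. (\<lambda>(k, l). S k l) i \<omega>) A"
  have meas: "g \<in> measurable (PiM A (\<lambda>_. count_space (UNIV :: 'n set set))) borel"
    if "finite A" for g :: "(nat \<times> nat \<Rightarrow> 'n set) \<Rightarrow> real" and A
    using measurable_compose[OF measurable_from_samples[OF that, of g], of "\<lambda>x. x" borel] by simp
  have "indep_var borel ((\<lambda>F. \<Phi> (?U F)) \<circ> ?X ?H) borel ((\<lambda>F. h (?U F k)) \<circ> ?X ?N)"
    by (rule indep_var_compose[OF indep_var_restrict[OF indep_S] meas meas]) auto
  moreover have "\<Phi> (?U (?X ?H \<omega>)) = \<Phi> (\<lambda>j. updated j \<omega>)" for \<omega>
    by (rule past) (simp add: updated_def)
  then have "(\<lambda>F. \<Phi> (?U F)) \<circ> ?X ?H = (\<lambda>\<omega>. \<Phi> (\<lambda>j. updated j \<omega>))"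
    by (simp add: fun_eq_iff)
  moreover have "(\<lambda>F. h (?U F k)) \<circ> ?X ?N = (\<lambda>\<omega>. h (updated k \<omega>))"
    by (simp add: fun_eq_iff updated_def)
  ultimately show ?thesis by simp
qed

lemma measurable_updated: "updated k \<in> measurable \<Omega> (count_space UNIV)"
  using measurable_history(1)[of "Suc k" "\<lambda>A. A k"] by simp

lemma events_updated: "{\<omega> \<in> space \<Omega>. Q (updated k \<omega>)} \<in> events"
  using measurable_sets[OF measurable_updated, of "{A. Q A}" k]
  by (simp add: vimage_def Int_def conj_commute)

lemma events_S: "l \<in> {1..c} \<Longrightarrow> {\<omega> \<in> space \<Omega>. Q (S k l \<omega>)} \<in> events"
  using measurable_sets[OF measurable_S, of l "{A. Q A}" k]
  by (simp add: vimage_def Int_def conj_commute)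

text \<open>Up to a null set, membership in the union is membership in the sample of the
  coordinate's own block. One block leaves a counting problem; two blocks give a product by
  independence.\<close>

lemma prob_updated_pair:
  "prob {\<omega> \<in> space \<Omega>. i \<in> updated k \<omega> \<and> j \<in> updated k \<omega>} = pair_prob i j"
proof -
  obtain l where l: "l \<in> {1..c}" "i \<in> P l" by (rule block_exists)
  obtain m where m: "m \<in> {1..c}" "j \<in> P m" by (rule block_exists)
  have ev: "{\<omega> \<in> space \<Omega>. i \<in> S k l \<omega> \<and> j \<in> S k m \<omega>} \<in> events"
    using sets.Int[OF events_S[OF l(1), of "\<lambda>A. i \<in> A" k] events_S[OF m(1), of "\<lambda>A. j \<in> A" k]]
    by (rule back_subst[of "\<lambda>X. X \<in> events"]) auto
  have "AE \<omega> in \<Omega>. i \<in> updated k \<omega> \<and> j \<in> updated k \<omega> \<longleftrightarrow> i \<in> S k l \<omega> \<and> j \<in> S k m \<omega>"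
    using updated_mem_iff_AE[OF l, of k] updated_mem_iff_AE[OF m, of k] by eventually_elim simp
  then have eq: "prob {\<omega> \<in> space \<Omega>. i \<in> updated k \<omega> \<and> j \<in> updated k \<omega>}
      = prob {\<omega> \<in> space \<Omega>. i \<in> S k l \<omega> \<and> j \<in> S k m \<omega>}"
    by (intro finite_measure_eq_AE ev events_updated) auto
  consider "i = j" | "i \<noteq> j" "l = m" | "l \<noteq> m" "i \<noteq> j" by blast
  then show ?thesis
  proof cases
    case 1
    then have "l = m" using l m block_unique by blast
    then show ?thesis using 1 eq prob_S_single[OF l] by (simp add: pair_prob_def)
  next
    case 2
    then have "same_block i j" using l m by (auto simp: same_block_def)
    moreover have "2 \<le> s" using card_mono[of "P l" "{i, j}"] l m 2 card_P[OF l(1)] by simp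
    ultimately show ?thesis using 2 eq prob_S_pair[OF l, of j k] m by (simp add: pair_prob_def max_def)
  next
    case 3
    have nb: "\<not> same_block i j" unfolding same_block_def using l m 3 block_unique by blast
    \<comment> \<open>The two indices differ, so the conditional assigns the event for
      \<open>i\<close> to block \<open>l\<close> and the event for \<open>j\<close> to block
      \<open>m\<close>.\<close>
    have "prob (\<Inter>x\<in>{(k, l), (k, m)}. (\<lambda>(k, l). S k l) x -` (if x = (k, l) then {A. i \<in> A} else {A. j \<in> A}) \<inter> space \<Omega>)
      = (\<Prod>x\<in>{(k, l), (k, m)}. prob ((\<lambda>(k, l). S k l) x -` (if x = (k, l) then {A. i \<in> A} else {A. j \<in> A}) \<inter> space \<Omega>))"
      by (rule indep_varsD[OF indep_S]) (use l m in auto)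
    then have "prob ((S k l -` {A. i \<in> A} \<inter> space \<Omega>) \<inter> (S k m -` {A. j \<in> A} \<inter> space \<Omega>))
        = prob (S k l -` {A. i \<in> A} \<inter> space \<Omega>) * prob (S k m -` {A. j \<in> A} \<inter> space \<Omega>)"
      using 3 by (simp add: Int_ac)
    also have "(S k l -` {A. i \<in> A} \<inter> space \<Omega>) \<inter> (S k m -` {A. j \<in> A} \<inter> space \<Omega>)
        = {\<omega> \<in> space \<Omega>. i \<in> S k l \<omega> \<and> j \<in> S k m \<omega>}" by auto
    also have "S k l -` {A. i \<in> A} \<inter> space \<Omega> = {\<omega> \<in> space \<Omega>. i \<in> S k l \<omega>}" by auto
    also have "S k m -` {A. j \<in> A} \<inter> space \<Omega> = {\<omega> \<in> space \<Omega>. j \<in> S k m \<omega>}" by auto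
    finally show ?thesis
      using 3 nb eq prob_S_single[OF l, of k] prob_S_single[OF m, of k] by (simp add: pair_prob_def)
  qed
qed

lemma prob_updated: "prob {\<omega> \<in> space \<Omega>. i \<in> updated k \<omega>} = real \<tau> / real s"
  using prob_updated_pair[of i k i] by (simp add: pair_prob_def)

lemma integrable_finite_range:
  fixes g :: "'x \<Rightarrow> real"
  assumes X: "X \<in> measurable \<Omega> (count_space UNIV)" and fin: "finite (X ` space \<Omega>)"
  shows "integrable \<Omega> (\<lambda>\<omega>. g (X \<omega>))"
proof (rule integrable_const_bound[where B = "Max ((\<lambda>x. norm (g x)) ` X ` space \<Omega>)"])
  show "AE \<omega> in \<Omega>. norm (g (X \<omega>)) \<le> Max ((\<lambda>x. norm (g x)) ` X ` space \<Omega>)"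
    using fin by (intro AE_I2 Max_ge) auto
  show "(\<lambda>\<omega>. g (X \<omega>)) \<in> borel_measurable \<Omega>"
    using measurable_compose[OF X, of g borel] by simp
qed

lemma integrable_updated:
  fixes g :: "'n set \<Rightarrow> real"
  shows "integrable \<Omega> (\<lambda>\<omega>. g (updated k \<omega>))"
  by (rule integrable_finite_range[OF measurable_updated]) simp

lemma expectation_linear:
  "expectation (\<lambda>\<omega>. \<Sum>i\<in>UNIV. of_bool (i \<in> updated k \<omega>) * w i) = real \<tau> / real s * (\<Sum>i\<in>UNIV. w i)"
proof -
  have "expectation (\<lambda>\<omega>. of_bool (i \<in> updated k \<omega>)) = real \<tau> / real s" for i
  proof -
    have "expectation (\<lambda>\<omega>. of_bool (i \<in> updated k \<omega>)) = expectation (indicator {\<omega> \<in> space \<Omega>. i \<in> updated k \<omega>} :: _ \<Rightarrow> real)"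
      by (intro Bochner_Integration.integral_cong) auto
    then show ?thesis using prob_updated[of i k] events_updated[of "\<lambda>A. i \<in> A" k] by simp
  qed
  moreover have "integrable \<Omega> (\<lambda>\<omega>. of_bool (i \<in> updated k \<omega>) :: real)" for i
    by (rule integrable_updated[of "\<lambda>A. of_bool (i \<in> A)"])
  ultimately show ?thesis
    by (subst Bochner_Integration.integral_sum) (auto simp: sum_distrib_left)
qed

lemma expectation_quadratic:
  "expectation (\<lambda>\<omega>. \<Sum>i\<in>UNIV. \<Sum>j\<in>UNIV. of_bool (i \<in> updated k \<omega> \<and> j \<in> updated k \<omega>) * w i j)
    = (\<Sum>i\<in>UNIV. \<Sum>j\<in>UNIV. pair_prob i j * w i j)"
proof -
  have "expectation (\<lambda>\<omega>. of_bool (i \<in> updated k \<omega> \<and> j \<in> updated k \<omega>)) = pair_prob i j" for i j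
  proof -
    have "expectation (\<lambda>\<omega>. of_bool (i \<in> updated k \<omega> \<and> j \<in> updated k \<omega>))
        = expectation (indicator {\<omega> \<in> space \<Omega>. i \<in> updated k \<omega> \<and> j \<in> updated k \<omega>} :: _ \<Rightarrow> real)"
      by (intro Bochner_Integration.integral_cong) auto
    then show ?thesis
      using prob_updated_pair[of i k j] events_updated[of "\<lambda>A. i \<in> A \<and> j \<in> A" k] by simp
  qed
  moreover have "integrable \<Omega> (\<lambda>\<omega>. of_bool (i \<in> updated k \<omega> \<and> j \<in> updated k \<omega>) * w i j)" for i j
    by (rule integrable_updated[of "\<lambda>A. of_bool (i \<in> A \<and> j \<in> A) * w i j"])
  ultimately show ?thesis
    by (subst Bochner_Integration.integral_sum; (subst Bochner_Integration.integral_sum)?)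
       (auto intro!: Bochner_Integration.integrable_sum sum.cong
         simp del: sum_of_bool_mult_eq sum_mult_of_bool_eq)
qed

text \<open>An elementary substitute for conditioning on the past. The integrand is split according
  to the finitely many values of the current update set, independence factors each summand, and the
  sum reassembles as an iterated expectation with the past frozen.\<close>

lemma expectation_step_le:
  fixes \<Phi> :: "(nat \<Rightarrow> 'n set) \<Rightarrow> 'x" and g :: "'x \<Rightarrow> 'n set \<Rightarrow> real"
  assumes past: "\<And>A B. (\<And>j. j < k \<Longrightarrow> A j = B j) \<Longrightarrow> \<Phi> A = \<Phi> B"
    and le: "\<And>\<omega>. \<omega> \<in> space \<Omega> \<Longrightarrow>
      expectation (\<lambda>\<omega>'. g (\<Phi> (\<lambda>j. updated j \<omega>)) (updated k \<omega>')) \<le> u (\<Phi> (\<lambda>j. updated j \<omega>))"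
  shows "expectation (\<lambda>\<omega>. g (\<Phi> (\<lambda>j. updated j \<omega>)) (updated k \<omega>)) \<le> expectation (\<lambda>\<omega>. u (\<Phi> (\<lambda>j. updated j \<omega>)))"
proof -
  define X where "X = (\<lambda>\<omega>. \<Phi> (\<lambda>j. updated j \<omega>))"
  define p where "p = (\<lambda>A. expectation (\<lambda>\<omega>. of_bool (updated k \<omega> = A) :: real))"
  have intX: "integrable \<Omega> (\<lambda>\<omega>. h (X \<omega>))" for h :: "'x \<Rightarrow> real"
    unfolding X_def by (intro integrable_finite_range measurable_history[of k \<Phi>] past) assumption+
  have intY: "integrable \<Omega> (\<lambda>\<omega>. of_bool (updated k \<omega> = A) :: real)" for A
    by (rule integrable_updated[of "\<lambda>B. of_bool (B = A)"])
  have split: "g x B = (\<Sum>A\<in>UNIV. g x A * of_bool (B = A))" for x B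
    by (simp add: of_bool_def if_distrib[of "\<lambda>u. _ * u"] cong: if_cong)
  have indepA: "indep_var borel (\<lambda>\<omega>. g (X \<omega>) A) borel (\<lambda>\<omega>. of_bool (updated k \<omega> = A) :: real)" for A
    unfolding X_def
    by (rule indep_history[of k "\<lambda>B. g (\<Phi> B) A" "\<lambda>B. of_bool (B = A)"]) (rule arg_cong[where f = "\<lambda>x. g x A"], rule past)
  have "expectation (\<lambda>\<omega>. g (X \<omega>) (updated k \<omega>))
      = expectation (\<lambda>\<omega>. \<Sum>A\<in>UNIV. g (X \<omega>) A * of_bool (updated k \<omega> = A))"
    by (rule Bochner_Integration.integral_cong[OF refl split])
  also have "\<dots> = (\<Sum>A\<in>UNIV. expectation (\<lambda>\<omega>. g (X \<omega>) A * of_bool (updated k \<omega> = A)))"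
    by (rule Bochner_Integration.integral_sum) (rule indep_var_integrable[OF indepA intX intY])
  also have "\<dots> = (\<Sum>A\<in>UNIV. expectation (\<lambda>\<omega>. g (X \<omega>) A * p A))"
    unfolding p_def by (intro sum.cong refl) (simp add: indep_var_lebesgue_integral[OF indepA intX intY])
  also have "\<dots> = expectation (\<lambda>\<omega>. \<Sum>A\<in>UNIV. g (X \<omega>) A * p A)"
    by (rule Bochner_Integration.integral_sum[symmetric]) (rule intX)
  also have "\<dots> = expectation (\<lambda>\<omega>. expectation (\<lambda>\<omega>'. g (X \<omega>) (updated k \<omega>')))"
  proof -
    have "expectation (\<lambda>\<omega>'. g x (updated k \<omega>')) = (\<Sum>A\<in>UNIV. g x A * p A)" for x
    proof -
      have "expectation (\<lambda>\<omega>'. g x (updated k \<omega>'))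
          = expectation (\<lambda>\<omega>'. \<Sum>A\<in>UNIV. g x A * of_bool (updated k \<omega>' = A))"
        by (rule Bochner_Integration.integral_cong[OF refl split])
      also have "\<dots> = (\<Sum>A\<in>UNIV. g x A * p A)"
        unfolding p_def using intY by (subst Bochner_Integration.integral_sum) auto
      finally show ?thesis .
    qed
    then show ?thesis by simp
  qed
  also have "\<dots> \<le> expectation (\<lambda>\<omega>. u (X \<omega>))"
    using le unfolding X_def[symmetric]
    by (intro integral_mono[OF intX[of "\<lambda>x. expectation (\<lambda>\<omega>'. g x (updated k \<omega>'))"] intX]) (simp add: X_def)
  finally show ?thesis unfolding X_def .
qed

end

subsection \<open>Expected decrease and convergence\<close>

text \<open>Restriction to the line through \<open>x\<close> and \<open>y\<close> reduces this to a
  tangent in one variable. It makes the gradient a subgradient, so that strong convexity of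
  \<open>f\<close> can be applied to it.\<close>

lemma convex_gradient_inequality:
  fixes f :: "'a::real_inner \<Rightarrow> real"
  assumes conv: "convex_on UNIV f" and grad: "GDERIV f x :> g"
  shows "f x + g \<bullet> (y - x) \<le> f y"
proof -
  let ?\<phi> = "\<lambda>t::real. f (x + t *\<^sub>R (y - x))"
  have "convex_on UNIV ?\<phi>"
  proof (rule convex_onI)
    fix t u v :: real
    assume t: "0 < t" "t < 1"
    have "x + ((1 - t) *\<^sub>R u + t *\<^sub>R v) *\<^sub>R (y - x)
        = (1 - t) *\<^sub>R (x + u *\<^sub>R (y - x)) + t *\<^sub>R (x + v *\<^sub>R (y - x))"
      by (simp add: algebra_simps)
    then show "?\<phi> ((1 - t) *\<^sub>R u + t *\<^sub>R v) \<le> (1 - t) * ?\<phi> u + t * ?\<phi> v"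
      using convex_onD[OF conv, of t "x + u *\<^sub>R (y - x)" "x + v *\<^sub>R (y - x)"] t by simp
  qed simp
  moreover have "(?\<phi> has_field_derivative g \<bullet> (y - x)) (at 0)"
  proof -
    have "(f has_derivative (\<lambda>h. h \<bullet> g)) (at (x + 0 *\<^sub>R (y - x)))"
      using grad by (simp add: gderiv_def)
    then have "(?\<phi> has_derivative (\<lambda>t. (t *\<^sub>R (y - x)) \<bullet> g)) (at 0)"
      by (rule has_derivative_compose[rotated]) (auto intro!: derivative_eq_intros)
    then show ?thesis
      by (simp add: has_field_derivative_def inner_commute mult.commute[of _ "g \<bullet> _"])
  qed
  ultimately have "?\<phi> 1 - ?\<phi> 0 \<ge> (g \<bullet> (y - x)) * (1 - 0)"
    by (intro convex_on_imp_above_tangent[of UNIV]) auto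
  then show ?thesis by simp
qed

text \<open>The form in which the iterate qualifies as a functional of the past.\<close>

lemma hydra_cong: "(\<And>j. j < k \<Longrightarrow> A j = B j) \<Longrightarrow> hydra f' R M \<beta> x0 A k = hydra f' R M \<beta> x0 B k"
  by (induction k) (simp_all add: Let_def)

locale hydra_run = uniform_block_sampling \<Omega> c s P \<tau> S
  for \<Omega> :: "'w measure" and c s :: nat and P :: "nat \<Rightarrow> 'n::finite set"
    and \<tau> :: nat and S :: "nat \<Rightarrow> nat \<Rightarrow> 'w \<Rightarrow> 'n set" +
  fixes f :: "real^'n \<Rightarrow> real" and f' :: "real^'n \<Rightarrow> real^'n"
    and M :: "real^'n^'n" and R :: "'n \<Rightarrow> real \<Rightarrow> ereal"
    and x_opt :: "real^'n" and \<mu>f \<mu>R \<beta> :: real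
  assumes f_gradient: "\<And>x. GDERIV f x :> f' x"
    and f_convex: "convex_on UNIV f"
    and M_pos_def: "positive_definite M"
    and f_upper: "\<And>x h. f (x + h) \<le> f x + f' x \<bullet> h + 1 / 2 * (h \<bullet> (M *v h))"
    and R_range: "\<And>i t. R i t \<noteq> -\<infinity>"
    and R_convex: "\<And>i. convex (ereal_epigraph (R i))"
    and R_closed: "\<And>i. closed (ereal_epigraph (R i))"
    and f_strong: "strongly_convex M \<mu>f (\<lambda>x. ereal (f x))"
    and R_strong: "strongly_convex M \<mu>R (\<lambda>x. \<Sum>i\<in>UNIV. R i (x $ i))"
    and mu: "0 \<le> \<mu>f" "0 \<le> \<mu>R" "0 < \<mu>f + \<mu>R"
    and beta: "beta_star c s \<tau> P M \<le> \<beta>"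
    and optimal: "\<And>x. objective f R x_opt \<le> objective f R x"
    and opt_dom: "\<And>i. R i (x_opt $ i) \<noteq> \<infinity>"
begin

text \<open>The points where the objective is finite. Iterates never leave this set, which allows
  real arithmetic; outside it \<open>r\<close> and \<open>obj\<close> are meaningless, since
  \<open>real_of_ereal\<close> sends infinity to 0.\<close>

definition dom :: "real^'n \<Rightarrow> bool" where
  "dom x \<longleftrightarrow> (\<forall>i. R i (x $ i) \<noteq> \<infinity>)"

definition r :: "'n \<Rightarrow> real \<Rightarrow> real" where
  "r i t = real_of_ereal (R i t)"

definition obj :: "real^'n \<Rightarrow> real" where
  "obj x = f x + (\<Sum>i\<in>UNIV. r i (x $ i))"

definition dir :: "real^'n \<Rightarrow> 'n \<Rightarrow> real" where
  "dir x i = hydra_dir f' R M \<beta> x i"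

definition step :: "real^'n \<Rightarrow> 'n set \<Rightarrow> real^'n" where
  "step x A = (\<chi> i. if i \<in> A then x $ i + dir x i else x $ i)"

definition rate :: real where
  "rate = (\<mu>f + \<mu>R) / (\<beta> + \<mu>R)"

lemma R_eq: "R i t \<noteq> \<infinity> \<Longrightarrow> R i t = ereal (r i t)"
  using R_range[of i t] unfolding r_def by (cases "R i t") auto

lemma objective_eq: "dom x \<Longrightarrow> objective f R x = ereal (obj x)"
  by (simp add: objective_def obj_def dom_def R_eq)

lemma dom_opt: "dom x_opt"
  using opt_dom by (simp add: dom_def)

lemma obj_opt_le: "dom x \<Longrightarrow> obj x_opt \<le> obj x"
  using optimal[of x] by (simp add: objective_eq dom_opt)

lemma beta_ge_1: "1 \<le> \<beta>"
  using one_le_beta_star[OF M_pos_def tau] beta by linarith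

lemma M_diag_pos: "0 < M $ i $ i"
  using positive_definite_diag_pos[OF M_pos_def] .

lemma f_lower: "f x + f' x \<bullet> h + \<mu>f / 2 * sqnorm M h \<le> f (x + h)"
proof -
  have "is_subgradient (\<lambda>x. ereal (f x)) x (f' x)"
    using convex_gradient_inequality[OF f_convex f_gradient] by (simp add: is_subgradient_def)
  then have "ereal (f x) + ereal (f' x \<bullet> h + \<mu>f / 2 * sqnorm M h) \<le> ereal (f (x + h))"
    using f_strong unfolding strongly_convex_def by blast
  then show ?thesis by simp
qed

text \<open>Along a coordinate axis the lower and upper bounds on \<open>f\<close> differ only in
  the factor \<open>\<mu>f\<close> against 1 before the same \<open>M $ i $ i\<close>.\<close>

lemma muf_le_1: "\<mu>f \<le> 1"
proof -
  obtain i :: 'n where True by simp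
  have "sqnorm M (axis i 1) = M $ i $ i"
    by (simp add: sqnorm_def axis_def if_distrib[of "\<lambda>u. u ^ 2"] if_distrib[of "\<lambda>u. _ * u"] cong: if_cong)
  then have "\<mu>f / 2 * M $ i $ i \<le> 1 / 2 * M $ i $ i"
    using f_lower[of 0 "axis i 1"] f_upper[of 0 "axis i 1"] by (simp add: quadratic_form_axis)
  then show ?thesis using M_diag_pos[of i] by simp
qed

lemma rate_bounds: "0 < rate" "rate \<le> 1"
  using beta_ge_1 muf_le_1 mu by (auto simp: rate_def)

text \<open>Comparison with the zero step shows that the chosen step has a finite value.\<close>

lemma dir_minimises:
  assumes "dom x"
  shows "R i (x $ i + dir x i) \<noteq> \<infinity>"
    and "R i (x $ i + t) \<noteq> \<infinity> \<Longrightarrow>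
      f' x $ i * dir x i + M $ i $ i * \<beta> / 2 * (dir x i)\<^sup>2 + r i (x $ i + dir x i)
        \<le> f' x $ i * t + M $ i $ i * \<beta> / 2 * t\<^sup>2 + r i (x $ i + t)"
proof -
  let ?F = "\<lambda>t. ereal (f' x $ i * t + M $ i $ i * \<beta> / 2 * t\<^sup>2) + R i (x $ i + t)"
  have xi: "R i (x $ i) \<noteq> \<infinity>" using assms by (simp add: dom_def)
  have "is_arg_min ?F (\<lambda>_. True) (dir x i)"
    unfolding dir_def hydra_dir_def
    using M_diag_pos[of i] beta_ge_1
    by (intro prox_is_arg_min R_convex R_closed R_range xi) auto
  then have le: "?F (dir x i) \<le> ?F t" for t
    by (simp add: is_arg_min_def not_less)
  show fin: "R i (x $ i + dir x i) \<noteq> \<infinity>"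
    using le[of 0] xi by auto
  show "f' x $ i * dir x i + M $ i $ i * \<beta> / 2 * (dir x i)\<^sup>2 + r i (x $ i + dir x i)
        \<le> f' x $ i * t + M $ i $ i * \<beta> / 2 * t\<^sup>2 + r i (x $ i + t)"
    if "R i (x $ i + t) \<noteq> \<infinity>"
    using le[of t] by (simp add: R_eq[OF fin] R_eq[OF that])
qed

lemma dom_step: "dom x \<Longrightarrow> dom (step x A)"
  using dir_minimises(1)[of x] by (auto simp: dom_def step_def)

lemma r_strongly_convex:
  assumes "dom x" "dom y" "0 \<le> t" "t \<le> 1"
  shows "r i (x $ i + t * (y $ i - x $ i)) \<le> (1 - t) * r i (x $ i) + t * r i (y $ i)
    - M $ i $ i * \<mu>R / 2 * (t * (1 - t) * (y $ i - x $ i)\<^sup>2)"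
    and "R i (x $ i + t * (y $ i - x $ i)) \<noteq> \<infinity>"
proof -
  have xy: "R i (x $ i) \<noteq> \<infinity>" "R i (y $ i) \<noteq> \<infinity>" using assms(1,2) by (auto simp: dom_def)
  have strong: "R i z + ereal (g * h + M $ i $ i * \<mu>R / 2 * h\<^sup>2) \<le> R i (z + h)"
    if "is_subgradient (R i) z g" for z g h
    by (rule strongly_convex_separable_coordinate[OF R_strong R_convex R_range opt_dom that])
  show "r i (x $ i + t * (y $ i - x $ i)) \<le> (1 - t) * r i (x $ i) + t * r i (y $ i)
    - M $ i $ i * \<mu>R / 2 * (t * (1 - t) * (y $ i - x $ i)\<^sup>2)"
    unfolding r_def
    using strong_convexity_from_subgradients[of "R i" "M $ i $ i * \<mu>R", OF R_convex R_range strong xy assms(3,4)]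
    by simp
  have "convex {t. R i t \<noteq> \<infinity>}"
    using convex_real_of_epigraph[OF R_convex R_range] by (rule convex_on_imp_convex)
  then have "(1 - t) *\<^sub>R x $ i + t *\<^sub>R y $ i \<in> {t. R i t \<noteq> \<infinity>}"
    by (rule convexD) (use xy assms in auto)
  then show "R i (x $ i + t * (y $ i - x $ i)) \<noteq> \<infinity>"
    by (simp add: algebra_simps)
qed

text \<open>Comparing with the step \<^term>\<open>rate *\<^sub>R (x_opt - x)\<close>; the value of \<^term>\<open>rate\<close> is the one
  for which the quadratic terms cancel.\<close>

lemma model_decrease:
  assumes x: "dom x"
  shows "(\<Sum>i\<in>UNIV. f' x $ i * dir x i + M $ i $ i * \<beta> / 2 * (dir x i)\<^sup>2 + (r i (x $ i + dir x i) - r i (x $ i)))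
    \<le> rate * (obj x_opt - obj x)"
proof -
  let ?e = "x_opt - x"
  \<comment> \<open>Multiplied by \<open>rate\<close>, this balances the quadratic cost of the
    comparison step against the gains from strong convexity: \<open>rate * (1 - rate)\<close> times
    \<open>\<mu>R\<close> from \<open>R\<close>, and \<open>rate\<close> times \<open>\<mu>f\<close>
    from \<open>f\<close>.\<close>
  have rate_eq: "\<beta> * rate = \<mu>R * (1 - rate) + \<mu>f"
    using beta_ge_1 mu unfolding rate_def by (simp add: field_simps)
  have "(\<Sum>i\<in>UNIV. f' x $ i * dir x i + M $ i $ i * \<beta> / 2 * (dir x i)\<^sup>2 + (r i (x $ i + dir x i) - r i (x $ i)))
    \<le> (\<Sum>i\<in>UNIV. rate * (f' x $ i * ?e $ i + r i (x_opt $ i) - r i (x $ i))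
        + rate * \<mu>f / 2 * (M $ i $ i * (?e $ i)\<^sup>2))"
  proof (rule sum_mono)
    fix i
    let ?t = "rate * ?e $ i"
    have "r i (x $ i + ?t) \<le> (1 - rate) * r i (x $ i) + rate * r i (x_opt $ i)
        - M $ i $ i * \<mu>R / 2 * (rate * (1 - rate) * (?e $ i)\<^sup>2)" "R i (x $ i + ?t) \<noteq> \<infinity>"
      using r_strongly_convex[OF x dom_opt, of rate i] rate_bounds by auto
    with dir_minimises(2)[OF x, of i ?t]
    have "f' x $ i * dir x i + M $ i $ i * \<beta> / 2 * (dir x i)\<^sup>2 + r i (x $ i + dir x i)
      \<le> f' x $ i * ?t + M $ i $ i * \<beta> / 2 * ?t\<^sup>2 + ((1 - rate) * r i (x $ i) + rate * r i (x_opt $ i)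
        - M $ i $ i * \<mu>R / 2 * (rate * (1 - rate) * (?e $ i)\<^sup>2))"
      by linarith
    moreover have "M $ i $ i * \<beta> / 2 * ?t\<^sup>2 - M $ i $ i * \<mu>R / 2 * (rate * (1 - rate) * (?e $ i)\<^sup>2)
        = rate * \<mu>f / 2 * (M $ i $ i * (?e $ i)\<^sup>2)"
    proof -
      have "M $ i $ i * \<beta> / 2 * ?t\<^sup>2 - M $ i $ i * \<mu>R / 2 * (rate * (1 - rate) * (?e $ i)\<^sup>2)
        = rate / 2 * (M $ i $ i * (?e $ i)\<^sup>2) * (\<beta> * rate - \<mu>R * (1 - rate))"
      by (simp add: field_simps power2_eq_square)
      also have "\<beta> * rate - \<mu>R * (1 - rate) = \<mu>f" using rate_eq by simp
      finally show ?thesis by simp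
    qed
    moreover have "rate * (f' x $ i * ?e $ i + r i (x_opt $ i) - r i (x $ i))
        = f' x $ i * ?t + rate * r i (x_opt $ i) - rate * r i (x $ i)"
      "(1 - rate) * r i (x $ i) = r i (x $ i) - rate * r i (x $ i)"
      by (simp_all add: algebra_simps)
    ultimately show "f' x $ i * dir x i + M $ i $ i * \<beta> / 2 * (dir x i)\<^sup>2 + (r i (x $ i + dir x i) - r i (x $ i))
      \<le> rate * (f' x $ i * ?e $ i + r i (x_opt $ i) - r i (x $ i)) + rate * \<mu>f / 2 * (M $ i $ i * (?e $ i)\<^sup>2)"
      by linarith
  qed
  also have "\<dots> = rate * (f' x \<bullet> ?e + \<mu>f / 2 * sqnorm M ?e
      + ((\<Sum>i\<in>UNIV. r i (x_opt $ i)) - (\<Sum>i\<in>UNIV. r i (x $ i))))"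
    by (simp add: sum.distrib sum_subtractf sum_distrib_left sum_divide_distrib inner_vec_def sqnorm_def algebra_simps)
  also have "\<dots> \<le> rate * (obj x_opt - obj x)"
    using f_lower[of x ?e] rate_bounds by (intro mult_left_mono) (auto simp: obj_def)
  finally show ?thesis .
qed

section \<open>Expected effect of one iteration\<close>

lemma pair_prob_quadratic_bound:
  "(\<Sum>i\<in>UNIV. \<Sum>j\<in>UNIV. pair_prob i j * (M $ i $ j * (h $ i * h $ j)))
    \<le> real \<tau> / real s * (\<beta> * sqnorm M h)"
proof -
  define p q where "p = (real \<tau> - 1) / max 1 (real s - 1)" and "q = real \<tau> / real s"
  let ?w = "\<lambda>i j. M $ i $ j * (h $ i * h $ j)"
  let ?B = "block_diag c P M"
  \<comment> \<open>Apart from the factor \<open>q\<close>, the weight of a pair is 1 on the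
    diagonal, \<open>p\<close> elsewhere in a block and \<open>q\<close> across blocks; a diagonal
    entry also lies in its block, hence \<open>1 - p\<close> plus \<open>p\<close>.\<close>
  have "pair_prob i j * ?w i j = q * ((1 - p) * (if i = j then ?w i j else 0)
      + p * (?B $ i $ j * (h $ i * h $ j)) + q * (?w i j - ?B $ i $ j * (h $ i * h $ j)))" for i j
  proof (cases "same_block i j")
    case True
    then have "?B $ i $ j = M $ i $ j" by (simp add: block_diag_def same_block_def)
    then show ?thesis using True by (simp add: pair_prob_def p_def[symmetric] q_def[symmetric] algebra_simps)
  next
    case False
    then have "?B $ i $ j = 0" "i \<noteq> j" using same_block_refl by (auto simp: block_diag_def same_block_def)
    then show ?thesis using False by (simp add: pair_prob_def q_def)
  qed
  then have "(\<Sum>i\<in>UNIV. \<Sum>j\<in>UNIV. pair_prob i j * ?w i j)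
      = (\<Sum>i\<in>UNIV. \<Sum>j\<in>UNIV. q * ((1 - p) * (if i = j then ?w i j else 0)
      + p * (?B $ i $ j * (h $ i * h $ j)) + q * (?w i j - ?B $ i $ j * (h $ i * h $ j))))"
    by simp
  also have "\<dots> = q * ((1 - p) * sqnorm M h + p * (h \<bullet> (?B *v h)) + q * (h \<bullet> (M *v h) - h \<bullet> (?B *v h)))"
    unfolding quadratic_form_eq_sum
    by (simp only: sum_distrib_left[symmetric] sum.distrib sum_subtractf)
       (simp add: sqnorm_def power2_eq_square)
  also have "\<dots> \<le> q * (beta_star c s \<tau> P M * sqnorm M h)"
    using beta_star_quadratic_bound[OF M_pos_def tau, of h]
    unfolding p_def q_def by (intro mult_left_mono) auto
  also have "\<dots> \<le> q * (\<beta> * sqnorm M h)"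
  proof -
    have "0 \<le> sqnorm M h"
      unfolding sqnorm_def using M_diag_pos by (intro sum_nonneg) (simp add: less_imp_le)
    then show ?thesis using beta by (intro mult_left_mono mult_right_mono) (auto simp: q_def)
  qed
  finally show ?thesis unfolding q_def .
qed

text \<open>Only \<open>f\<close> is estimated; the change in \<open>R\<close> is exact by
  separability. Membership indicators put both parts in the shape whose expectations are
  known.\<close>

lemma obj_step_le:
  "obj (step x A) \<le> obj x
    + (\<Sum>i\<in>UNIV. of_bool (i \<in> A) * (f' x $ i * dir x i + (r i (x $ i + dir x i) - r i (x $ i))))
    + 1 / 2 * (\<Sum>i\<in>UNIV. \<Sum>j\<in>UNIV. of_bool (i \<in> A \<and> j \<in> A) * (M $ i $ j * (dir x i * dir x j)))"
proof -
  define h where "h = (\<chi> i. if i \<in> A then dir x i else 0)"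
  have st: "step x A = x + h" by (simp add: step_def h_def vec_eq_iff)
  have "f' x \<bullet> h = (\<Sum>i\<in>UNIV. of_bool (i \<in> A) * (f' x $ i * dir x i))"
    unfolding inner_vec_def by (intro sum.cong) (auto simp: h_def)
  moreover have "h \<bullet> (M *v h) = (\<Sum>i\<in>UNIV. \<Sum>j\<in>UNIV. of_bool (i \<in> A \<and> j \<in> A) * (M $ i $ j * (dir x i * dir x j)))"
    unfolding quadratic_form_eq_sum by (intro sum.cong) (auto simp: h_def)
  moreover have "(\<Sum>i\<in>UNIV. r i (step x A $ i))
      = (\<Sum>i\<in>UNIV. r i (x $ i)) + (\<Sum>i\<in>UNIV. of_bool (i \<in> A) * (r i (x $ i + dir x i) - r i (x $ i)))"
    unfolding sum.distrib[symmetric] by (intro sum.cong) (auto simp: step_def)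
  moreover have "f (step x A) \<le> f x + f' x \<bullet> h + 1 / 2 * (h \<bullet> (M *v h))"
    unfolding st by (rule f_upper)
  ultimately show ?thesis
    unfolding obj_def by (simp only: distrib_left sum.distrib)
qed

text \<open>Here \<open>x\<close> is a fixed point and only the update set is random. After the pair
  bound, the expected change is at most \<open>\<tau>/s\<close> times the separable model with
  coefficient \<open>\<beta>\<close>, the very model that the coordinate steps minimise.\<close>

lemma expected_step:
  assumes x: "dom x"
  shows "expectation (\<lambda>\<omega>. obj (step x (updated k \<omega>)) - obj x_opt)
    \<le> (1 - real \<tau> / real s * rate) * (obj x - obj x_opt)"
proof -
  let ?q = "real \<tau> / real s"
  let ?w1 = "\<lambda>i. f' x $ i * dir x i + (r i (x $ i + dir x i) - r i (x $ i))"
  let ?w2 = "\<lambda>i j. M $ i $ j * (dir x i * dir x j)"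
  let ?L = "\<lambda>A. \<Sum>i\<in>UNIV. of_bool (i \<in> A) * ?w1 i"
  let ?Q = "\<lambda>A. \<Sum>i\<in>UNIV. \<Sum>j\<in>UNIV. of_bool (i \<in> A \<and> j \<in> A) * ?w2 i j"
  have "obj (step x A) - obj x_opt \<le> (obj x - obj x_opt) + (?L A + 1 / 2 * ?Q A)" for A
    using obj_step_le[of x A] by linarith
  then have "expectation (\<lambda>\<omega>. obj (step x (updated k \<omega>)) - obj x_opt)
      \<le> expectation (\<lambda>\<omega>. (obj x - obj x_opt) + (?L (updated k \<omega>) + 1 / 2 * ?Q (updated k \<omega>)))"
    by (intro integral_mono integrable_updated[of "\<lambda>A. obj (step x A) - obj x_opt"]
        integrable_updated[of "\<lambda>A. (obj x - obj x_opt) + (?L A + 1 / 2 * ?Q A)"])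
  also have "\<dots> = (obj x - obj x_opt) + (expectation (\<lambda>\<omega>. ?L (updated k \<omega>)) + 1 / 2 * expectation (\<lambda>\<omega>. ?Q (updated k \<omega>)))"
    using integrable_updated[of ?L k] integrable_updated[of ?Q k]
    by (simp add: prob_space del: sum_of_bool_mult_eq sum_mult_of_bool_eq)
  also have "\<dots> \<le> (obj x - obj x_opt) + (?q * (\<Sum>i\<in>UNIV. ?w1 i) + 1 / 2 * (?q * (\<beta> * sqnorm M (\<chi> i. dir x i))))"
    unfolding expectation_linear expectation_quadratic
    using pair_prob_quadratic_bound[of "\<chi> i. dir x i"] by simp
  also have "\<dots> = (obj x - obj x_opt) + ?q * (\<Sum>i\<in>UNIV. f' x $ i * dir x i + M $ i $ i * \<beta> / 2 * (dir x i)\<^sup>2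
      + (r i (x $ i + dir x i) - r i (x $ i)))"
  proof -
    have "\<beta> / 2 * sqnorm M (\<chi> i. dir x i) = (\<Sum>i\<in>UNIV. M $ i $ i * \<beta> / 2 * (dir x i)\<^sup>2)"
      by (simp add: sqnorm_def sum_distrib_left mult_ac)
    moreover have "1 / 2 * (?q * (\<beta> * N)) = ?q * (\<beta> / 2 * N)" for N by simp
    ultimately show ?thesis by (simp only: sum.distrib distrib_left)
  qed
  also have "\<dots> \<le> (obj x - obj x_opt) + ?q * (rate * (obj x_opt - obj x))"
    by (intro add_left_mono mult_left_mono model_decrease x) simp
  finally show ?thesis by (simp add: algebra_simps diff_divide_distrib)
qed

section \<open>Convergence of the random iterates\<close>

definition iterate :: "real^'n \<Rightarrow> nat \<Rightarrow> 'w \<Rightarrow> real^'n" where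
  "iterate x0 k \<omega> = hydra f' R M \<beta> x0 (\<lambda>j. updated j \<omega>) k"

lemma iterate_Suc: "iterate x0 (Suc k) \<omega> = step (iterate x0 k \<omega>) (updated k \<omega>)"
  unfolding iterate_def step_def dir_def hydra.simps Let_def ..

lemma dom_iterate: "dom x0 \<Longrightarrow> dom (iterate x0 k \<omega>)"
  by (induction k) (simp_all add: iterate_Suc dom_step, simp add: iterate_def)

lemma integrable_iterate:
  fixes g :: "real^'n \<Rightarrow> real"
  shows "integrable \<Omega> (\<lambda>\<omega>. g (iterate x0 k \<omega>))"
proof -
  have past: "hydra f' R M \<beta> x0 A k = hydra f' R M \<beta> x0 B k" if "\<And>j. j < k \<Longrightarrow> A j = B j" for A B
    using that by (rule hydra_cong)
  show ?thesis
    unfolding iterate_def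
    by (rule integrable_finite_range[OF measurable_history[of k "\<lambda>A. hydra f' R M \<beta> x0 A k", OF past]])
qed

lemma contraction_bounds: "0 < real \<tau> / real s * rate" "real \<tau> / real s * rate \<le> 1"
proof -
  show "0 < real \<tau> / real s * rate" using rate_bounds tau s_pos by simp
  show "real \<tau> / real s * rate \<le> 1" using rate_bounds tau s_pos by (intro mult_le_one) auto
qed

lemma expected_gap:
  assumes x0: "dom x0"
  shows "expectation (\<lambda>\<omega>. obj (iterate x0 k \<omega>) - obj x_opt)
    \<le> (1 - real \<tau> / real s * rate) ^ k * (obj x0 - obj x_opt)"
proof (induction k)
  case 0
  then show ?case by (simp add: iterate_def prob_space)
next
  case (Suc k)
  let ?\<gamma> = "1 - real \<tau> / real s * rate"
  have "expectation (\<lambda>\<omega>. obj (iterate x0 (Suc k) \<omega>) - obj x_opt)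
      \<le> expectation (\<lambda>\<omega>. ?\<gamma> * (obj (iterate x0 k \<omega>) - obj x_opt))"
    unfolding iterate_Suc unfolding iterate_def
    by (rule expectation_step_le[where g = "\<lambda>x A. obj (step x A) - obj x_opt"
          and u = "\<lambda>x. ?\<gamma> * (obj x - obj x_opt)" and \<Phi> = "\<lambda>A. hydra f' R M \<beta> x0 A k"])
      (blast intro: hydra_cong, rule expected_step[OF dom_iterate[OF x0, unfolded iterate_def]])
  also have "\<dots> = ?\<gamma> * expectation (\<lambda>\<omega>. obj (iterate x0 k \<omega>) - obj x_opt)"
    by (rule integral_mult_right_zero)
  also have "\<dots> \<le> ?\<gamma> * (?\<gamma> ^ k * (obj x0 - obj x_opt))"
    using Suc.IH contraction_bounds by (intro mult_left_mono) auto
  finally show ?case by (simp add: mult.assoc)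
qed

text \<open>The factor before the logarithm is \<open>1 / ?g\<close>, so \<open>T\<close> makes
  \<open>exp (- ?g * T)\<close> at most \<open>\<epsilon> * \<rho> / ?\<Delta>\<close>. Since
  \<open>(1 - ?g)^T\<close> is no larger, the expected gap is at most
  \<open>\<epsilon> * \<rho>\<close>, and Markov's inequality at level \<open>\<epsilon>\<close>
  leaves \<open>\<rho>\<close>.\<close>

lemma convergence_in_probability:
  assumes x0: "dom x0" and rho: "0 < \<rho>" and eps: "0 < \<epsilon>" "\<epsilon> < obj x0 - obj x_opt"
    and T: "real s / real \<tau> * ((\<beta> + \<mu>R) / (\<mu>f + \<mu>R)) * ln ((obj x0 - obj x_opt) / (\<epsilon> * \<rho>)) \<le> real T"
  shows "1 - \<rho> \<le> prob {\<omega> \<in> space \<Omega>. obj (iterate x0 T \<omega>) - obj x_opt \<le> \<epsilon>}"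
proof -
  let ?g = "real \<tau> / real s * rate" and ?\<Delta> = "obj x0 - obj x_opt"
  let ?Y = "\<lambda>\<omega>. obj (iterate x0 T \<omega>) - obj x_opt"
  note g = contraction_bounds
  have "ln (?\<Delta> / (\<epsilon> * \<rho>)) / ?g \<le> real T" using T by (simp add: rate_def mult_ac)
  then have "ln (?\<Delta> / (\<epsilon> * \<rho>)) \<le> ?g * real T"
    unfolding pos_divide_le_eq[OF g(1)] by (simp only: mult.commute)
  then have "exp (ln (?\<Delta> / (\<epsilon> * \<rho>))) \<le> exp (?g * real T)"
    by (simp only: exp_le_cancel_iff)
  then have "?\<Delta> / (\<epsilon> * \<rho>) \<le> exp (?g * real T)"
    using eps rho by (subst (asm) exp_ln) simp_all
  then have D: "?\<Delta> * exp (- (?g * real T)) \<le> \<epsilon> * \<rho>"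
    using eps rho by (simp add: exp_minus field_simps)
  have "(1 - ?g) ^ T \<le> exp (- ?g) ^ T"
    using g exp_ge_add_one_self[of "- ?g"] by (intro power_mono) auto
  also have "\<dots> = exp (- (?g * real T))" by (simp flip: exp_of_nat_mult)
  finally have "(1 - ?g) ^ T * ?\<Delta> \<le> exp (- (?g * real T)) * ?\<Delta>"
    using eps by (intro mult_right_mono) auto
  then have E: "expectation ?Y \<le> \<epsilon> * \<rho>"
    using expected_gap[OF x0, of T] D by (simp add: mult.commute)
  have intY: "integrable \<Omega> ?Y" by (rule integrable_iterate[of "\<lambda>x. obj x - obj x_opt"])
  have "prob {\<omega> \<in> space \<Omega>. \<epsilon> \<le> ?Y \<omega>} \<le> expectation ?Y / \<epsilon>"
    using dom_iterate[OF x0] obj_opt_le eps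
    by (intro integral_Markov_inequality_measure[OF intY, of "{}"]) auto
  also have "\<dots> \<le> \<rho>" using E eps by (simp add: divide_le_eq mult.commute)
  finally have *: "prob {\<omega> \<in> space \<Omega>. \<epsilon> \<le> ?Y \<omega>} \<le> \<rho>" .
  have [measurable]: "?Y \<in> borel_measurable \<Omega>" using intY by simp
  have "1 - prob {\<omega> \<in> space \<Omega>. \<epsilon> \<le> ?Y \<omega>} = prob {\<omega> \<in> space \<Omega>. \<not> \<epsilon> \<le> ?Y \<omega>}"
    by (rule prob_neg[symmetric]) measurable
  also have "\<dots> \<le> prob {\<omega> \<in> space \<Omega>. ?Y \<omega> \<le> \<epsilon>}"
    by (rule finite_measure_mono) auto
  finally show ?thesis using * by linarith
qed

end

theorem theorem5:
  fixes f :: "real^'n \<Rightarrow> real" and f' :: "real^'n \<Rightarrow> real^'n"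
    and M :: "real^'n^'n"
    and R :: "'n \<Rightarrow> real \<Rightarrow> ereal"
    and x_opt x0 :: "real^'n"
    and \<mu>f \<mu>R \<beta> \<rho> \<epsilon> :: real
    and c s \<tau> T :: nat
    and P :: "nat \<Rightarrow> 'n set"
    and \<Omega> :: "'w measure"
    and S :: "nat \<Rightarrow> nat \<Rightarrow> 'w \<Rightarrow> 'n set"
  defines "L \<equiv> objective f R"
  assumes f_gradient: "\<And>x. GDERIV f x :> f' x"
    and f_convex: "convex_on UNIV f"
    and M_pos_def: "positive_definite M"
    and f_upper: "\<And>x h. f (x + h) \<le> f x + f' x \<bullet> h + 1 / 2 * (h \<bullet> (M *v h))"
    and R_range: "\<And>i t. R i t \<noteq> -\<infinity>"
    and R_convex: "\<And>i. convex (ereal_epigraph (R i))"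
    and R_closed: "\<And>i. closed (ereal_epigraph (R i))"
    and optimal: "\<And>x. L x_opt \<le> L x"
    and f_strong: "strongly_convex M \<mu>f (\<lambda>x. ereal (f x))"
    and R_strong: "strongly_convex M \<mu>R (\<lambda>x. \<Sum>i\<in>UNIV. R i (x $ i))"
    and mu: "0 \<le> \<mu>f" "0 \<le> \<mu>R" "0 < \<mu>f + \<mu>R"
    and cs: "0 < c" "0 < s" "CARD('n) = c * s"
    and P_partition: "disjoint_family_on P {1..c}" "(\<Union>l\<in>{1..c}. P l) = UNIV"
    and P_card: "\<And>l. l \<in> {1..c} \<Longrightarrow> card (P l) = s"
    and tau: "1 \<le> \<tau>" "\<tau> \<le> s"
    and x0_dom: "L x0 < \<infinity>"
    and rho: "0 < \<rho>" "\<rho> < 1"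
    and eps: "0 < \<epsilon>" "ereal \<epsilon> < L x0 - L x_opt"
    and beta: "beta_star c s \<tau> P M \<le> \<beta>"
    and T_bound: "real CARD('n) / (real c * real \<tau>) * ((\<beta> + \<mu>R) / (\<mu>f + \<mu>R))
                    * ln (real_of_ereal (L x0 - L x_opt) / (\<epsilon> * \<rho>)) \<le> real T"
    and prob: "prob_space \<Omega>"
    and sampling: "hydra_sampling \<Omega> c \<tau> P S"
  shows "1 - \<rho> \<le> measure \<Omega> {\<omega> \<in> space \<Omega>.
           L (hydra f' R M \<beta> x0 (\<lambda>k. \<Union>l\<in>{1..c}. S k l \<omega>) T) - L x_opt \<le> ereal \<epsilon>}"
proof -
  \<comment> \<open>In \<open>ereal\<close> a sum with one infinite term is infinite, so a finite
    objective forces every coordinate into the domain of its \<open>R i\<close>.\<close>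
  have dom: "R i (x $ i) \<noteq> \<infinity>" if "L x < \<infinity>" for x i
  proof
    assume "R i (x $ i) = \<infinity>"
    then have "(\<Sum>i\<in>UNIV. R i (x $ i)) = \<infinity>"
      using sum_Pinfty[of "\<lambda>i. R i (x $ i)" UNIV] by auto
    then show False using that by (simp add: L_def objective_def)
  qed
  have "L x_opt < \<infinity>" using optimal[of x0] x0_dom by (rule le_less_trans)
  interpret prob_space \<Omega> by (rule prob)
  interpret H: hydra_run \<Omega> c s P \<tau> S f f' M R x_opt \<mu>f \<mu>R \<beta>
    by unfold_locales
      (fact cs P_partition P_card tau sampling f_gradient f_convex M_pos_def f_upper R_range R_convex
        R_closed f_strong R_strong mu beta optimal[unfolded L_def] dom[OF \<open>L x_opt < \<infinity>\<close>])+
  have x0: "H.dom x0" using dom[OF x0_dom] by (simp add: H.dom_def)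
  have L: "L x - L x_opt = ereal (H.obj x - H.obj x_opt)" if "H.dom x" for x
    using H.objective_eq[OF that] H.objective_eq[OF H.dom_opt] by (simp add: L_def)
  have "real CARD('n) / (real c * real \<tau>) = real s / real \<tau>" using cs by simp
  then have "1 - \<rho> \<le> prob {\<omega> \<in> space \<Omega>. H.obj (H.iterate x0 T \<omega>) - H.obj x_opt \<le> \<epsilon>}"
    using T_bound eps rho by (intro H.convergence_in_probability x0) (simp_all add: L[OF x0])
  moreover have "hydra f' R M \<beta> x0 (\<lambda>k. \<Union>l\<in>{1..c}. S k l \<omega>) T = H.iterate x0 T \<omega>" for \<omega>
    by (simp add: H.iterate_def H.updated_def)
  ultimately show ?thesis
    by (simp add: L[OF H.dom_iterate[OF x0]])
qed

end
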